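(* Let $M:\mathbb{R}^m\times\mathbb{R}^n\rightrightarrows\mathbb{R}^d$ have closed graph and let $S:\mathbb{R}^m\rightrightarrows\mathbb{R}^n$ be $S(w)=\{x\mid 0\in M(w,x)\}$. Let $W\subseteq\mathbb{R}^m$ be a closed set and let $\bar x\in S|_W(\bar w)$. (1) If the basic constraint qualification $$(0,0)\in D^*M|_{W\times\mathbb{R}^n}\big((\bar w,\bar x)\mid0\big)(y)\ \Longrightarrow\ y=0$$ holds, then for every $r\in\mathbb{R}^n$ $$D^*_WS(\bar w\mid\bar x)(r)\subseteq\limsup_{\substack{(w,x)\to(\bar w,\bar x),\ (w,x)\in\operatorname{gph} S|_W\\ r'\to r}}\ \bigcup_{y\in\mathbb{R}^d}\Big\{\operatorname{proj}_{T_W(w)}(v)\ \Big|\ (v,-r')\in D^*M|_{W\times\mathbb{R}^n}\big((w,x)\mid0\big)(y)\Big\}.$$ (2) If the strong constraint qualification $$(0,0)\in D^*_{W\times\mathbb{R}^n}M\big((\bar w,\bar x)\mid0\big)(y)\ \Longrightarrow\ y=0$$ holds, then for every $r\in\mathbb{R}^n$ $$D^*_WS(\bar w\mid\bar x)(r)\subseteq\Big\{t\ \Big|\ \exists\,y:\ (t,-r)\in D^*_{W\times\mathbb{R}^n}M\big((\bar w,\bar x)\mid0\big)(y)\Big\}.$$ (3) If, in addition to the strong constraint qualification in (2), $M|_{W\times\mathbb{R}^n}$ is graphically regular at $(\bar w,\bar x,0)$ and $W$ is a smooth manifold at $\bar w$, then the right-hand sides of the inclusions in (1) and (2) are identical and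 both inclusions hold as equalities.
   Context: For a multifunction $F$: $\operatorname{gph}F=\{(x,u)\mid u\in F(x)\}$; the restriction $F|_X(x)$ equals $F(x)$ if $x\in X$ and $\emptyset$ otherwise. $\limsup$ of sets is the outer limit. For $C\subset\mathbb{R}^n$ and $x\in C$: $T_C(x)$ is the contingent cone ($w$ such that $x+t_kw_k\in C$ for some $t_k\searrow0$, $w_k\to w$); $\widehat N_C(x)$ is the polar of $T_C(x)$; $N_C(x)$ is the limiting normal cone (limits of $v_k\in\widehat N_C(x_k)$, $x_k\to x$ in $C$). All are empty for $x\notin C$. $C$ is regular at $x$ if it is locally closed there and $\widehat N_C(x)=N_C(x)$; a multifunction is graphically regular at a point of its graph if its graph is regular there. Coderivative: $x^*\in D^*F(\bar x\mid\bar u)(u^* )$ iff $(x^*,-u^* )\in N_{\operatorname{gph}F}(\bar x,\bar u)$. Projections: $\operatorname{proj}_C(x)=\{y\in C\mid\|y-x\|=d(x,C)\}$ (possibly multivalued), $\operatorname{proj}_CZ=\bigcup_{z\in Z}\operatorname{proj}_C(z)$; $\{\operatorname{proj}_C(v)\mid\dots\}$ denotes the union of the sets $\operatorname{proj}_C(v)$ over the indicated $v$. Projectional coderivative of $F:\mathbb{R}^p\rightrightarrows\mathbb{R}^s$ at $\bar x\in X\subseteq\mathbb{R}^p$ for $\bar u\in F(\bar x)$ with respect to $X$: $t^*\in D^*_XF(\bar x\mid\bar u)(u^* )$ iff $$(t^*,-u^* )\in\limsup_{(x,u)\to(\bar x,\bar u),\ (x,u)\in\operatorname{gph}F|_X}\operatorname{proj}_{T_X(x)\times\mathbb{R}^s}N_{\operatorname{gph}F|_X}(x,u).$$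 (It is applied both to $S$ with $X=W$ and to $M$ with $X=W\times\mathbb{R}^n$.) $W\subset\mathbb{R}^m$ is a ($d'$-dimensional) smooth manifold at (around) $\bar w\in W$ if there are an open neighborhood $O$ of $\bar w$ and a $\mathcal{C}^1$ mapping $\Phi:O\to\mathbb{R}^{m-d'}$ with $\nabla\Phi(\bar w)$ of full rank $m-d'$ and $W\cap O=\{w\in O\mid\Phi(w)=0\}$. *)

theory Defs
  imports "HOL-Analysis.Analysis"
begin

definition gph :: "('a \<Rightarrow> 'b set) \<Rightarrow> ('a \<times> 'b) set" where
  "gph F = {(x, u). u \<in> F x}"

definition mrestrict :: "('a \<Rightarrow> 'b set) \<Rightarrow> 'a set \<Rightarrow> 'a \<Rightarrow> 'b set" where
  "mrestrict F X x = (if x \<in> X then F x else {})"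

text \<open>Outer limit of the sets \<open>G z\<close> as \<open>z\<close> tends to \<open>zbar\<close> within \<open>D\<close>; as usual in
  variational analysis, the value \<open>z = zbar\<close> itself is not excluded.\<close>

definition outer_limit ::
    "('a::metric_space \<Rightarrow> 'b::metric_space set) \<Rightarrow> 'a \<Rightarrow> 'a set \<Rightarrow> 'b set" where
  "outer_limit G zbar D =
    {v. \<exists>z vs. (\<forall>k::nat. z k \<in> D \<and> vs k \<in> G (z k)) \<and> z \<longlonglongrightarrow> zbar \<and> vs \<longlonglongrightarrow> v}"

definition tangent_cone :: "'a::euclidean_space set \<Rightarrow> 'a \<Rightarrow> 'a set" where
  "tangent_cone C x =
    {w. x \<in> C \<and> (\<exists>t ws. (\<forall>k::nat. t k > (0::real) \<and> x + t k *\<^sub>R ws k \<in> C) \<and>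
                      t \<longlonglongrightarrow> 0 \<and> ws \<longlonglongrightarrow> w)}"

definition polar_cone :: "'a::euclidean_space set \<Rightarrow> 'a set" where
  "polar_cone K = {v. \<forall>w\<in>K. v \<bullet> w \<le> 0}"

definition regular_normal_cone :: "'a::euclidean_space set \<Rightarrow> 'a \<Rightarrow> 'a set" where
  "regular_normal_cone C x = (if x \<in> C then polar_cone (tangent_cone C x) else {})"

definition normal_cone :: "'a::euclidean_space set \<Rightarrow> 'a \<Rightarrow> 'a set" where
  "normal_cone C x = (if x \<in> C then outer_limit (regular_normal_cone C) x C else {})"

definition locally_closed_at :: "'a::euclidean_space set \<Rightarrow> 'a \<Rightarrow> bool" where
  "locally_closed_at C x \<longleftrightarrow> (\<exists>V. closed V \<and> x \<in> interior V \<and> closed (C \<inter> V))"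

definition regular_at :: "'a::euclidean_space set \<Rightarrow> 'a \<Rightarrow> bool" where
  "regular_at C x \<longleftrightarrow>
    x \<in> C \<and> locally_closed_at C x \<and> regular_normal_cone C x = normal_cone C x"

definition graphically_regular_at ::
    "('a::euclidean_space \<Rightarrow> 'b::euclidean_space set) \<Rightarrow> 'a \<Rightarrow> 'b \<Rightarrow> bool" where
  "graphically_regular_at F x u \<longleftrightarrow> regular_at (gph F) (x, u)"

definition coderivative ::
    "('a::euclidean_space \<Rightarrow> 'b::euclidean_space set) \<Rightarrow> 'a \<Rightarrow> 'b \<Rightarrow> 'b \<Rightarrow> 'a set" where
  "coderivative F x u u' = {x'. (x', - u') \<in> normal_cone (gph F) (x, u)}"

text \<open>The set of nearest points. Although \<open>infdist x {} = 0\<close>, the projection onto the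
  empty set is empty because of the requirement \<open>y \<in> C\<close>.\<close>

definition projection :: "'a::euclidean_space set \<Rightarrow> 'a \<Rightarrow> 'a set" where
  "projection C x = {y \<in> C. norm (y - x) = infdist x C}"

definition projection_of_set :: "'a::euclidean_space set \<Rightarrow> 'a set \<Rightarrow> 'a set" where
  "projection_of_set C Z = (\<Union>z\<in>Z. projection C z)"

definition proj_coderivative ::
    "('a::euclidean_space \<Rightarrow> 'b::euclidean_space set) \<Rightarrow> 'a set \<Rightarrow> 'a \<Rightarrow> 'b \<Rightarrow> 'b \<Rightarrow> 'a set" where
  "proj_coderivative F X xbar ubar u' =
    {t'. (t', - u') \<in>
      outer_limit
        (\<lambda>(x, u). projection_of_set (tangent_cone X x \<times> UNIV)
                    (normal_cone (gph (mrestrict F X)) (x, u)))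
        (xbar, ubar) (gph (mrestrict F X))}"

text \<open>The codomain of dimension \<open>DIM('a) - d'\<close> may be zero-dimensional and depends on
  \<open>d'\<close>, so the defining mapping is given by its components \<open>\<Phi> i\<close>, \<open>i < DIM('a) - d'\<close>.
  The vectors \<open>g i w\<close> are the rows of the Jacobian at \<open>w\<close>; the condition on \<open>dim\<close> says
  that the Jacobian at \<open>wbar\<close> has full (row) rank.\<close>

definition smooth_manifold_of_dim_at :: "nat \<Rightarrow> 'a::euclidean_space set \<Rightarrow> 'a \<Rightarrow> bool" where
  "smooth_manifold_of_dim_at d' W wbar \<longleftrightarrow>
    d' \<le> DIM('a) \<and> wbar \<in> W \<and>
    (\<exists>U (\<Phi> :: nat \<Rightarrow> 'a \<Rightarrow> real) (g :: nat \<Rightarrow> 'a \<Rightarrow> 'a).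
      open U \<and> wbar \<in> U \<and>
      (\<forall>i < DIM('a) - d'. (\<forall>w\<in>U. GDERIV (\<Phi> i) w :> g i w) \<and> continuous_on U (g i)) \<and>
      dim ((\<lambda>i. g i wbar) ` {..< DIM('a) - d'}) = DIM('a) - d' \<and>
      W \<inter> U = {w \<in> U. \<forall>i < DIM('a) - d'. \<Phi> i w = 0})"

definition smooth_manifold_at :: "'a::euclidean_space set \<Rightarrow> 'a \<Rightarrow> bool" where
  "smooth_manifold_at W wbar \<longleftrightarrow> (\<exists>d'. smooth_manifold_of_dim_at d' W wbar)"

definition basic_CQ ::
    "('a::euclidean_space \<times> 'b::euclidean_space \<Rightarrow> 'c::euclidean_space set) \<Rightarrow>
     'a set \<Rightarrow> 'a \<Rightarrow> 'b \<Rightarrow> bool" where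
  "basic_CQ M W wbar xbar \<longleftrightarrow>
    (\<forall>y. (0, 0) \<in> coderivative (mrestrict M (W \<times> UNIV)) (wbar, xbar) 0 y \<longrightarrow> y = 0)"

definition strong_CQ ::
    "('a::euclidean_space \<times> 'b::euclidean_space \<Rightarrow> 'c::euclidean_space set) \<Rightarrow>
     'a set \<Rightarrow> 'a \<Rightarrow> 'b \<Rightarrow> bool" where
  "strong_CQ M W wbar xbar \<longleftrightarrow>
    (\<forall>y. (0, 0) \<in> proj_coderivative M (W \<times> UNIV) (wbar, xbar) 0 y \<longrightarrow> y = 0)"

text \<open>The right-hand sides of the two estimates, with \<open>S\<close> the solution mapping of \<open>M\<close>.\<close>

definition outer_estimate ::
    "('a::euclidean_space \<times> 'b::euclidean_space \<Rightarrow> 'c::euclidean_space set) \<Rightarrow>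
     ('a \<Rightarrow> 'b set) \<Rightarrow> 'a set \<Rightarrow> 'a \<Rightarrow> 'b \<Rightarrow> 'b \<Rightarrow> 'a set" where
  "outer_estimate M S W wbar xbar r =
    outer_limit
      (\<lambda>((w, x), r'). \<Union>y. projection_of_set (tangent_cone W w)
         {v. (v, - r') \<in> coderivative (mrestrict M (W \<times> UNIV)) (w, x) 0 y})
      ((wbar, xbar), r) (gph (mrestrict S W) \<times> UNIV)"

definition pointwise_estimate ::
    "('a::euclidean_space \<times> 'b::euclidean_space \<Rightarrow> 'c::euclidean_space set) \<Rightarrow>
     'a set \<Rightarrow> 'a \<Rightarrow> 'b \<Rightarrow> 'b \<Rightarrow> 'a set" where
  "pointwise_estimate M W wbar xbar r =
    {t. \<exists>y. (t, - r) \<in> proj_coderivative M (W \<times> UNIV) (wbar, xbar) 0 y}"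

end

theory Submission
  imports Defs
begin

text \<open>
  Write \<open>G\<close> for the graph of \<open>M\<close> restricted to \<open>W \<times> UNIV\<close>; the graph of the restricted solution
  mapping is the section \<open>{z. (z, 0) \<in> G}\<close>. Minimizing \<open>norm (z - a)\<^sup>2 + c * norm (u)\<^sup>2\<close> over \<open>G\<close>
  with \<open>c\<close> large approximates a normal of the section by the first component of a regular normal
  \<open>(v, y)\<close> of \<open>G\<close>. The components \<open>y\<close> stay bounded in the limit: otherwise rescaling would
  produce a normal \<open>(0, y)\<close> with \<open>y \<noteq> 0\<close>, which the basic constraint qualification (stable under
  small perturbations of the base point) forbids. The same rescaling argument for projected normals,
  with the strong qualification, gives the pointwise estimate.

  If \<open>W\<close> is a smooth manifold, its tangent spaces are the kernels of the Jacobian, so that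
  projecting a normal of \<open>G\<close> subtracts a combination of gradients. This combination extends to a
  continuous field of normals of \<open>W\<close>, hence projected normals of \<open>G\<close> are again normals of \<open>G\<close>.
  In the limit they are regular normals by graphical regularity, and regular normals of \<open>G\<close>
  restrict to regular normals of the section.
\<close>

section \<open>Outer limits, cones and projections\<close>

text \<open>In this form a limit of limits is handled by halving \<open>e\<close>, with no diagonal
  sequence to extract.\<close>

lemma outer_limit_iff:
  "v \<in> outer_limit G zbar D \<longleftrightarrow>
    (\<forall>e>0. \<exists>z\<in>D. \<exists>v'\<in>G z. dist z zbar < e \<and> dist v' v < e)"
proof
  assume "v \<in> outer_limit G zbar D"
  then obtain z vs where *: "\<And>k::nat. z k \<in> D \<and> vs k \<in> G (z k)"
    and lim: "z \<longlonglongrightarrow> zbar" "vs \<longlonglongrightarrow> v"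
    unfolding outer_limit_def by auto
  show "\<forall>e>0. \<exists>z\<in>D. \<exists>v'\<in>G z. dist z zbar < e \<and> dist v' v < e"
  proof (intro allI impI)
    fix e :: real assume "e > 0"
    then have "\<forall>\<^sub>F k in sequentially. dist (z k) zbar < e \<and> dist (vs k) v < e"
      using lim by (intro eventually_conj tendstoD)
    then obtain k where "dist (z k) zbar < e \<and> dist (vs k) v < e"
      by (auto simp: eventually_sequentially)
    then show "\<exists>z\<in>D. \<exists>v'\<in>G z. dist z zbar < e \<and> dist v' v < e"
      using * by blast
  qed
next
  assume R: "\<forall>e>0. \<exists>z\<in>D. \<exists>v'\<in>G z. dist z zbar < e \<and> dist v' v < e"
  have "\<forall>k::nat. \<exists>z v'. z \<in> D \<and> v' \<in> G z \<and>
      dist z zbar < inverse (real (Suc k)) \<and> dist v' v < inverse (real (Suc k))"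
    using R by (metis of_nat_0_less_iff positive_imp_inverse_positive zero_less_Suc)
  then obtain z vs where *: "\<And>k. z k \<in> D \<and> vs k \<in> G (z k) \<and>
      dist (z k) zbar < inverse (real (Suc k)) \<and> dist (vs k) v < inverse (real (Suc k))"
    by metis
  have "z \<longlonglongrightarrow> zbar" "vs \<longlonglongrightarrow> v"
    unfolding tendsto_dist_iff[of _ zbar] tendsto_dist_iff[of _ v]
    by (rule tendsto_sandwich[OF _ _ tendsto_const LIMSEQ_inverse_real_of_nat];
        use * in \<open>auto intro!: always_eventually less_imp_le\<close>)+
  then show "v \<in> outer_limit G zbar D"
    using * unfolding outer_limit_def by blast
qed

lemma outer_limitI:
  assumes "\<And>k. z k \<in> D" "\<And>k. vs k \<in> G (z k)" "z \<longlonglongrightarrow> zbar" "vs \<longlonglongrightarrow> v"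
  shows "v \<in> outer_limit G zbar D"
  using assms unfolding outer_limit_def by blast

lemma outer_limitE:
  assumes "v \<in> outer_limit G zbar D"
  obtains z vs where "\<And>k::nat. z k \<in> D" "\<And>k. vs k \<in> G (z k)" "z \<longlonglongrightarrow> zbar" "vs \<longlonglongrightarrow> v"
proof -
  from assms obtain z vs where "\<forall>k::nat. z k \<in> D \<and> vs k \<in> G (z k)" "z \<longlonglongrightarrow> zbar" "vs \<longlonglongrightarrow> v"
    unfolding outer_limit_def by blast
  then show thesis by (intro that[of z vs]) auto
qed

text \<open>The diagonal argument behind outer semicontinuity of the limiting normal cone: one
  element of the sequence within \<open>e/2\<close>, then one approximant of it within
  \<open>e/2\<close>.\<close>

lemma outer_limit_idem:
  assumes lim: "z \<longlonglongrightarrow> zbar" "vs \<longlonglongrightarrow> v"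
    and mem: "\<And>k. vs k \<in> outer_limit G (z k) D"
  shows "v \<in> outer_limit G zbar D"
  unfolding outer_limit_iff
proof (intro allI impI)
  fix e :: real assume e: "e > 0"
  then have "\<forall>\<^sub>F k in sequentially. dist (z k) zbar < e/2 \<and> dist (vs k) v < e/2"
    using lim by (intro eventually_conj tendstoD) auto
  then obtain k where k: "dist (z k) zbar < e/2 \<and> dist (vs k) v < e/2"
    by (auto simp: eventually_sequentially)
  obtain z' v' where "z' \<in> D" "v' \<in> G z'" "dist z' (z k) < e/2" "dist v' (vs k) < e/2"
    using mem[of k] e unfolding outer_limit_iff by (meson half_gt_zero)
  moreover from this have "dist z' zbar < e" "dist v' v < e"
    using k dist_triangle[of z' zbar "z k"] dist_triangle[of v' v "vs k"] by linarith+
  ultimately show "\<exists>z\<in>D. \<exists>v'\<in>G z. dist z zbar < e \<and> dist v' v < e"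
    by blast
qed

section \<open>Contingent cones\<close>

lemma tangent_coneI:
  assumes "x \<in> C" "\<And>k. t k > 0" "\<And>k. x + t k *\<^sub>R ws k \<in> C" "t \<longlonglongrightarrow> 0" "ws \<longlonglongrightarrow> w"
  shows "w \<in> tangent_cone C x"
  unfolding tangent_cone_def mem_Collect_eq using assms by (intro conjI exI[of _ t] exI[of _ ws]) auto

lemma tangent_coneE:
  assumes "w \<in> tangent_cone C x"
  obtains t ws where "x \<in> C" "\<And>k::nat. t k > 0" "\<And>k. x + t k *\<^sub>R ws k \<in> C" "t \<longlonglongrightarrow> 0" "ws \<longlonglongrightarrow> w"
  using assms unfolding tangent_cone_def by auto

lemma zero_mem_tangent_cone: "x \<in> C \<Longrightarrow> 0 \<in> tangent_cone C x"
  by (rule tangent_coneI[OF _ _ _ LIMSEQ_inverse_real_of_nat tendsto_const]) auto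

lemma tangent_cone_scale:
  assumes "w \<in> tangent_cone C x" "c > 0"
  shows "c *\<^sub>R w \<in> tangent_cone C x"
  using assms(1)
proof (rule tangent_coneE)
  fix t ws
  assume *: "x \<in> C" "\<And>k::nat. t k > 0" "\<And>k. x + t k *\<^sub>R ws k \<in> C" "t \<longlonglongrightarrow> 0" "ws \<longlonglongrightarrow> w"
  have "(\<lambda>k. t k / c) \<longlonglongrightarrow> 0 / c"
    by (intro tendsto_intros *) (use assms(2) in simp)
  then show ?thesis
    by (intro tangent_coneI[where t="\<lambda>k. t k / c" and ws="\<lambda>k. c *\<^sub>R ws k"] tendsto_intros)
      (use * assms(2) in auto)
qed

text \<open>An affine map carries the defining sequences over with the same step sizes. It serves
  both for coordinate projections, which send tangents of a graph to tangents of its domain set, and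
  for the embedding of a section by \<open>(z, 0)\<close>.\<close>

lemma tangent_cone_linear_image:
  assumes f: "bounded_linear f" and sub: "\<And>z. z \<in> C \<Longrightarrow> c + f z \<in> D"
    and w: "w \<in> tangent_cone C x"
  shows "f w \<in> tangent_cone D (c + f x)"
  using w
proof (rule tangent_coneE)
  interpret bounded_linear f by (rule f)
  fix t ws
  assume *: "x \<in> C" "\<And>k::nat. t k > 0" "\<And>k. x + t k *\<^sub>R ws k \<in> C" "t \<longlonglongrightarrow> 0" "ws \<longlonglongrightarrow> w"
  have "c + f x + t k *\<^sub>R f (ws k) \<in> D" for k
    using sub[OF *(3)[of k]] by (simp add: add scaleR add.assoc)
  then show ?thesis
    by (intro tangent_coneI[where t=t and ws="\<lambda>k. f (ws k)"] tendsto) (use * sub in auto)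
qed

lemma tangent_cone_Times_UNIV:
  "tangent_cone (C \<times> UNIV) (x, u) = tangent_cone C x \<times> UNIV"
proof (intro equalityI subsetI)
  fix p assume "p \<in> tangent_cone (C \<times> UNIV) (x, u)"
  then have "fst p \<in> tangent_cone C (0 + fst (x, u))"
    by (rule tangent_cone_linear_image[OF bounded_linear_fst, rotated]) auto
  then show "p \<in> tangent_cone C x \<times> UNIV"
    by (simp add: mem_Times_iff)
next
  fix p :: "'a \<times> 'b" assume "p \<in> tangent_cone C x \<times> UNIV"
  then have "fst p \<in> tangent_cone C x" by auto
  then show "p \<in> tangent_cone (C \<times> UNIV) (x, u)"
  proof (rule tangent_coneE)
    fix t ws
    assume *: "x \<in> C" "\<And>k::nat. t k > 0" "\<And>k. x + t k *\<^sub>R ws k \<in> C" "t \<longlonglongrightarrow> 0"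
      "ws \<longlonglongrightarrow> fst p"
    have "(\<lambda>k. (ws k, snd p)) \<longlonglongrightarrow> (fst p, snd p)" by (intro tendsto_intros *)
    then show ?thesis
      by (intro tangent_coneI[where t=t and ws="\<lambda>k. (ws k, snd p)"]) (use * in auto)
  qed
qed

section \<open>Regular and limiting normal cones\<close>

lemma regular_normal_cone_scale:
  assumes "v \<in> regular_normal_cone C x" "c \<ge> 0"
  shows "c *\<^sub>R v \<in> regular_normal_cone C x"
  using assms
  by (auto simp: regular_normal_cone_def polar_cone_def mult_nonneg_nonpos split: if_splits)

lemma regular_normal_cone_subset: "regular_normal_cone C x \<subseteq> normal_cone C x"
  by (auto simp: normal_cone_def regular_normal_cone_def intro!: outer_limitI[of "\<lambda>_. x" C])

lemma normal_cone_scale: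
  assumes "v \<in> normal_cone C x" "c \<ge> 0"
  shows "c *\<^sub>R v \<in> normal_cone C x"
proof -
  have x: "x \<in> C" and "v \<in> outer_limit (regular_normal_cone C) x C"
    using assms(1) by (auto simp: normal_cone_def split: if_splits)
  then obtain z vs where *: "\<And>k::nat. z k \<in> C \<and> vs k \<in> regular_normal_cone C (z k)"
    "z \<longlonglongrightarrow> x" "vs \<longlonglongrightarrow> v"
    unfolding outer_limit_def by auto
  have "c *\<^sub>R v \<in> outer_limit (regular_normal_cone C) x C"
    by (rule outer_limitI[of z _ "\<lambda>k. c *\<^sub>R vs k"])
      (use * assms(2) in \<open>auto intro!: tendsto_intros regular_normal_cone_scale\<close>)
  then show ?thesis using x by (simp add: normal_cone_def)
qed

lemma normal_cone_outer_semicontinuous: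
  assumes "z \<longlonglongrightarrow> x" "vs \<longlonglongrightarrow> v" "\<And>k. vs k \<in> normal_cone C (z k)" "x \<in> C"
  shows "v \<in> normal_cone C x"
proof -
  have "vs k \<in> outer_limit (regular_normal_cone C) (z k) C" for k
    using assms(3)[of k] by (auto simp: normal_cone_def split: if_splits)
  then show ?thesis
    using outer_limit_idem[OF assms(1,2)] assms(4) by (simp add: normal_cone_def)
qed

text \<open>If the bound failed at points \<open>y k\<close> tending to \<open>x\<close>, the unit
  vectors towards them would accumulate at a tangent direction \<open>l\<close> with
  \<open>v \<bullet> l \<ge> e\<close>, against polarity.\<close>

lemma regular_normal_cone_little_o:
  assumes v: "v \<in> regular_normal_cone C x" and e: "e > 0"
  obtains d where "d > 0"
    "\<And>y. y \<in> C \<Longrightarrow> dist y x < d \<Longrightarrow> v \<bullet> (y - x) \<le> e * norm (y - x)"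
proof (rule ccontr)
  assume "\<not> thesis"
  then have "\<forall>d>0. \<exists>y\<in>C. dist y x < d \<and> v \<bullet> (y - x) > e * norm (y - x)"
    using that by (metis not_le)
  then have "\<forall>k. \<exists>y\<in>C. dist y x < inverse (real (Suc k)) \<and> v \<bullet> (y - x) > e * norm (y - x)"
    by (metis of_nat_0_less_iff positive_imp_inverse_positive zero_less_Suc)
  then obtain y where y: "\<And>k. y k \<in> C" "\<And>k. dist (y k) x < inverse (real (Suc k))"
    "\<And>k. v \<bullet> (y k - x) > e * norm (y k - x)"
    by metis
  define u where "u k = sgn (y k - x)" for k
  have ne: "y k \<noteq> x" for k using y(3)[of k] e by auto
  then have "\<forall>k. u k \<in> sphere 0 1" by (auto simp: u_def norm_sgn)
  then obtain l r where l: "strict_mono r" "(u \<circ> r) \<longlonglongrightarrow> l"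
    using compact_sphere[of "0::'a" 1] unfolding compact_def by metis
  have "y \<longlonglongrightarrow> x"
    unfolding tendsto_dist_iff[of _ x]
    by (rule tendsto_sandwich[OF _ _ tendsto_const LIMSEQ_inverse_real_of_nat])
      (use y(2) in \<open>auto intro!: always_eventually less_imp_le\<close>)
  then have nlim: "(\<lambda>k. norm (y (r k) - x)) \<longlonglongrightarrow> 0"
    using LIMSEQ_subseq_LIMSEQ[OF _ l(1)] by (force simp: tendsto_dist_iff[of _ x] dist_norm o_def)
  have eq: "x + norm (y k - x) *\<^sub>R u k = y k" for k
    by (simp add: u_def sgn_div_norm ne)
  have "x \<in> C" using v by (auto simp: regular_normal_cone_def split: if_splits)
  then have "l \<in> tangent_cone C x"
    by (rule tangent_coneI[OF _ _ _ nlim l(2)]) (use ne eq y(1) in auto)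
  then have "v \<bullet> l \<le> 0"
    using v by (auto simp: regular_normal_cone_def polar_cone_def split: if_splits)
  moreover have "v \<bullet> l \<ge> e"
  proof (rule LIMSEQ_le_const)
    show "(\<lambda>k. v \<bullet> (u \<circ> r) k) \<longlonglongrightarrow> v \<bullet> l" by (intro tendsto_intros l)
    have "v \<bullet> u k \<ge> e" for k
      using y(3)[of k] ne[of k] by (simp add: u_def sgn_div_norm divide_inverse_commute[symmetric] pos_le_divide_eq)
    then show "\<exists>N. \<forall>n\<ge>N. e \<le> v \<bullet> (u \<circ> r) n" by auto
  qed
  ultimately show False using e by simp
qed

section \<open>Nearest-point projections\<close>

lemma mem_projection_iff:
  "y \<in> projection C x \<longleftrightarrow> y \<in> C \<and> (\<forall>z\<in>C. norm (y - x) \<le> norm (z - x))"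
proof (cases "C = {}")
  case False
  have "norm (y - x) = infdist x C \<longleftrightarrow> (\<forall>z\<in>C. norm (y - x) \<le> norm (z - x))" if "y \<in> C"
  proof
    assume "norm (y - x) = infdist x C"
    then show "\<forall>z\<in>C. norm (y - x) \<le> norm (z - x)"
      by (metis dist_commute dist_norm infdist_le)
  next
    assume "\<forall>z\<in>C. norm (y - x) \<le> norm (z - x)"
    then have "norm (y - x) \<le> infdist x C"
      unfolding infdist_notempty[OF False]
      by (intro cINF_greatest False) (auto simp: dist_norm norm_minus_commute)
    then show "norm (y - x) = infdist x C"
      using infdist_le[OF that, of x] by (simp add: dist_norm norm_minus_commute)
  qed
  then show ?thesis by (auto simp: projection_def)
qed (simp add: projection_def)

text \<open>The squared distance splits over the two factors, and the free factor reaches distance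
  zero exactly at \<open>b = a\<close>.\<close>

lemma projection_Times_UNIV:
  "(y, b) \<in> projection (C \<times> UNIV) (v, a) \<longleftrightarrow> y \<in> projection C v \<and> b = a"
proof
  assume R: "(y, b) \<in> projection (C \<times> UNIV) (v, a)"
  then have y: "y \<in> C" and min: "\<And>z c. z \<in> C \<Longrightarrow> norm (y - v, b - a) \<le> norm (z - v, c - a)"
    unfolding mem_projection_iff by auto
  have "(norm (y - v, b - a))\<^sup>2 \<le> (norm (y - v, a - a))\<^sup>2"
    by (rule power_mono[OF min[OF y]]) simp
  then have "b = a" by (simp add: norm_Pair)
  moreover have "norm (y - v) \<le> norm (z - v)" if "z \<in> C" for z
    using min[OF that, of b] by (simp add: norm_Pair)
  ultimately show "y \<in> projection C v \<and> b = a"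
    using y by (simp add: mem_projection_iff)
next
  assume "y \<in> projection C v \<and> b = a"
  then show "(y, b) \<in> projection (C \<times> UNIV) (v, a)"
    unfolding mem_projection_iff
    by (auto simp: norm_Pair intro: order_trans[OF _ real_sqrt_sum_squares_ge1])
qed

lemma projection_scale:
  assumes K: "\<And>w c. w \<in> K \<Longrightarrow> c > 0 \<Longrightarrow> c *\<^sub>R w \<in> K" and t: "t \<in> projection K v" and c: "c > 0"
  shows "c *\<^sub>R t \<in> projection K (c *\<^sub>R v)"
  unfolding mem_projection_iff
proof (intro conjI ballI)
  show "c *\<^sub>R t \<in> K" using t K c by (simp add: mem_projection_iff)
  fix z assume "z \<in> K"
  then have "norm (t - v) \<le> norm (inverse c *\<^sub>R z - v)"
    using t K c by (simp add: mem_projection_iff)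
  then have "c * norm (t - v) \<le> c * norm (inverse c *\<^sub>R z - v)" using c by simp
  then show "norm (c *\<^sub>R t - c *\<^sub>R v) \<le> norm (z - c *\<^sub>R v)"
    using c norm_scaleR[of c "t - v"] norm_scaleR[of c "inverse c *\<^sub>R z - v"]
    by (simp add: scaleR_right_diff_distrib del: norm_scaleR)
qed

lemma projection_self: "y \<in> C \<Longrightarrow> y \<in> projection C y"
  by (simp add: mem_projection_iff)

lemma projection_of_set_scale:
  assumes "\<And>w c. w \<in> K \<Longrightarrow> c > 0 \<Longrightarrow> c *\<^sub>R w \<in> K" "\<And>w c. w \<in> Z \<Longrightarrow> c > 0 \<Longrightarrow> c *\<^sub>R w \<in> Z"
    and "t \<in> projection_of_set K Z" "c > 0"
  shows "c *\<^sub>R t \<in> projection_of_set K Z"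
  using assms projection_scale[of K] unfolding projection_of_set_def by (metis UN_iff)

text \<open>Stated for an arbitrary cone-valued \<open>H\<close>, so that one compactness argument
  serves the regular normals of a graph under the basic qualification and the projected normals
  under the strong one.\<close>

lemma outer_limit_cone_lift:
  fixes H :: "'z::metric_space \<Rightarrow> ('a::euclidean_space \<times> 'b::euclidean_space) set"
  assumes cone: "\<And>z p c. p \<in> H z \<Longrightarrow> c > 0 \<Longrightarrow> c *\<^sub>R p \<in> H z"
    and cq: "\<And>y. (0, y) \<in> outer_limit H zbar D \<Longrightarrow> y = 0"
    and z: "\<And>k::nat. z k \<in> D" "z \<longlonglongrightarrow> zbar"
    and H: "\<And>k. (vs k, ys k) \<in> H (z k)" and vs: "vs \<longlonglongrightarrow> v"
  obtains y where "(v, y) \<in> outer_limit H zbar D"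
proof -
  \<comment> \<open>Rescaling by \<open>s k\<close> keeps the second components bounded whatever \<open>ys\<close> does; the scales
    cannot tend to 0, for then the limit would be \<open>(0, y)\<close> with \<open>norm y = 1\<close>.\<close>
  define s where "s k = inverse (1 + norm (ys k))" for k
  have s: "s k > 0" "s k \<le> 1" "norm (s k *\<^sub>R ys k) = 1 - s k" for k
  proof -
    have p: "1 + norm (ys k) > 0" using norm_ge_zero[of "ys k"] by linarith
    then show "s k > 0" "s k \<le> 1" by (auto simp: s_def field_simps)
    then show "norm (s k *\<^sub>R ys k) = 1 - s k"
      using p by (simp add: s_def field_simps)
  qed
  have "seq_compact ({0..1::real} \<times> cball (0::'b) 1)"
    by (intro compact_imp_seq_compact compact_Times compact_Icc compact_cball)
  moreover have "\<forall>k. (s k, s k *\<^sub>R ys k) \<in> {0..1} \<times> cball 0 1"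
    using s(1,2) s(3) by (auto simp del: norm_scaleR intro: less_imp_le)
  ultimately obtain l r where l: "strict_mono (r :: nat \<Rightarrow> nat)" "((\<lambda>k. (s k, s k *\<^sub>R ys k)) \<circ> r) \<longlonglongrightarrow> l"
    by (rule seq_compactE)
  have ls: "(\<lambda>k. s (r k)) \<longlonglongrightarrow> fst l" and ly: "(\<lambda>k. s (r k) *\<^sub>R ys (r k)) \<longlonglongrightarrow> snd l"
    using tendsto_fst[OF l(2)] tendsto_snd[OF l(2)] by (auto simp: o_def)
  have zr: "(\<lambda>k. z (r k)) \<longlonglongrightarrow> zbar" and vr: "(\<lambda>k. vs (r k)) \<longlonglongrightarrow> v"
    using LIMSEQ_subseq_LIMSEQ[OF _ l(1)] z(2) vs by (auto simp: o_def)
  have mem: "(s (r k) *\<^sub>R vs (r k), s (r k) *\<^sub>R ys (r k)) \<in> H (z (r k))" for k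
    using cone[OF H s(1)] by (metis scaleR_Pair)
  have "(fst l *\<^sub>R v, snd l) \<in> outer_limit H zbar D"
  proof (rule outer_limitI[where G = H and z = "\<lambda>k. z (r k)"
        and vs = "\<lambda>k. (s (r k) *\<^sub>R vs (r k), s (r k) *\<^sub>R ys (r k))"])
    show "(\<lambda>k. (s (r k) *\<^sub>R vs (r k), s (r k) *\<^sub>R ys (r k))) \<longlonglongrightarrow> (fst l *\<^sub>R v, snd l)"
      by (intro tendsto_Pair tendsto_scaleR ls vr ly)
  qed (rule z mem zr)+
  have "norm (snd l) = 1 - fst l"
    by (rule LIMSEQ_unique[OF tendsto_norm[OF ly]]) (unfold s(3), intro tendsto_intros ls)
  have "fst l \<noteq> 0"
  proof
    assume 0: "fst l = 0"
    then have "snd l = 0"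
      using cq \<open>(fst l *\<^sub>R v, snd l) \<in> _\<close> by auto
    with \<open>norm (snd l) = 1 - fst l\<close> 0 show False by simp
  qed
  have "(v, inverse (fst l) *\<^sub>R snd l) \<in> outer_limit H zbar D"
  proof (rule outer_limitI[where G = H and z = "\<lambda>k. z (r k)"
        and vs = "\<lambda>k. (vs (r k), ys (r k))"])
    show "(vs (r k), ys (r k)) \<in> H (z (r k))" for k by (rule H)
    have "(\<lambda>k. inverse (s (r k)) *\<^sub>R (s (r k) *\<^sub>R ys (r k))) \<longlonglongrightarrow> inverse (fst l) *\<^sub>R snd l"
      by (intro tendsto_intros ls ly \<open>fst l \<noteq> 0\<close>)
    moreover have "inverse (s k) *\<^sub>R (s k *\<^sub>R ys k) = ys k" for k
      using s(1)[of k] by simp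
    ultimately show "(\<lambda>k. (vs (r k), ys (r k))) \<longlonglongrightarrow> (v, inverse (fst l) *\<^sub>R snd l)"
      by (auto intro!: tendsto_Pair vr)
  qed (rule z zr)+
  then show thesis by (rule that)
qed

section \<open>Normals of a section of a closed set\<close>

text \<open>First-order optimality: the pair is minus half the gradient of the penalized objective
  at \<open>q\<close>, and the objective cannot decrease along tangent directions of
  \<open>G\<close>.\<close>

lemma regular_normal_cone_minimizer:
  fixes G :: "('a::euclidean_space \<times> 'b::euclidean_space) set"
  assumes q: "q \<in> G" and c: "c \<ge> 0"
    and min: "\<And>p. p \<in> G \<Longrightarrow>
      (norm (fst q - a))\<^sup>2 + c * (norm (snd q))\<^sup>2 \<le> (norm (fst p - a))\<^sup>2 + c * (norm (snd p))\<^sup>2"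
  shows "(a - fst q, - c *\<^sub>R snd q) \<in> regular_normal_cone G q"
proof -
  have "(a - fst q, - c *\<^sub>R snd q) \<bullet> w \<le> 0" if "w \<in> tangent_cone G q" for w
    using that
  proof (rule tangent_coneE)
    fix t ws
    assume *: "\<And>k::nat. t k > 0" "\<And>k. q + t k *\<^sub>R ws k \<in> G" "t \<longlonglongrightarrow> 0" "ws \<longlonglongrightarrow> w"
    \<comment> \<open>\<open>D k\<close> is the increment of the objective from \<open>q\<close> to
      \<open>q + t k *\<^sub>R ws k\<close>, divided by \<open>t k\<close>; the quadratic term
      disappears as \<open>t k\<close> tends to 0.\<close>
    define D where "D k = 2 * ((fst q - a) \<bullet> fst (ws k) + c * (snd q \<bullet> snd (ws k))) +
      t k * ((norm (fst (ws k)))\<^sup>2 + c * (norm (snd (ws k)))\<^sup>2)" for k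
    have "0 \<le> t k * D k" for k
      using min[OF *(2)[of k]]
      by (simp add: D_def power2_norm_eq_inner inner_commute algebra_simps)
    then have D: "0 \<le> D k" for k
      using *(1)[of k] by (metis zero_le_mult_iff not_le)
    have "D \<longlonglongrightarrow> 2 * ((fst q - a) \<bullet> fst w + c * (snd q \<bullet> snd w)) +
      0 * ((norm (fst w))\<^sup>2 + c * (norm (snd w))\<^sup>2)"
      unfolding D_def by (intro tendsto_intros *)
    then have "0 \<le> 2 * ((fst q - a) \<bullet> fst w + c * (snd q \<bullet> snd w))"
      using D by (intro LIMSEQ_le_const) auto
    then show "(a - fst q, - c *\<^sub>R snd q) \<bullet> w \<le> 0"
      by (cases w) (simp add: algebra_simps)
  qed
  then show ?thesis
    using q by (simp add: regular_normal_cone_def polar_cone_def)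
qed

text \<open>Since \<open>c \<ge> 1\<close>, the objective dominates the squared distance to
  \<open>(a, 0)\<close>. Outside the ball of radius \<open>norm (z - a)\<close> it therefore exceeds
  its value at \<open>(z, 0)\<close>, and minimizing over the compact part of \<open>G\<close> in
  that ball is enough.\<close>

lemma penalty_minimizer_exists:
  fixes G :: "('a::euclidean_space \<times> 'b::euclidean_space) set"
  assumes "closed G" "(z, 0) \<in> G" "c \<ge> 1"
  obtains q where "q \<in> G"
    "\<And>p. p \<in> G \<Longrightarrow>
      (norm (fst q - a))\<^sup>2 + c * (norm (snd q))\<^sup>2 \<le> (norm (fst p - a))\<^sup>2 + c * (norm (snd p))\<^sup>2"
proof -
  define f where "f p = (norm (fst p - a))\<^sup>2 + c * (norm (snd p))\<^sup>2" for p :: "'a \<times> 'b"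
  define K where "K = G \<inter> cball (a, 0) (norm (z - a))"
  have "compact K" unfolding K_def by (intro closed_Int_compact assms compact_cball)
  moreover have "(z, 0) \<in> K"
    using assms(2) by (simp add: K_def dist_Pair_Pair dist_norm norm_minus_commute)
  moreover have "continuous_on K f"
    unfolding f_def by (intro continuous_intros)
  ultimately obtain q where q: "q \<in> K" "\<And>p. p \<in> K \<Longrightarrow> f q \<le> f p"
    using continuous_attains_inf[of K f] by blast
  show thesis
  proof (rule that[of q])
    show "q \<in> G" using q by (simp add: K_def)
    fix p assume p: "p \<in> G"
    have "f q \<le> f p"
    proof (cases "p \<in> K")
      case False
      have "f q \<le> (norm (z - a))\<^sup>2" using q(2)[OF \<open>(z, 0) \<in> K\<close>] by (simp add: f_def)
      also have "\<dots> \<le> (dist (a, 0) p)\<^sup>2"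
        using False p by (intro power_mono) (auto simp: K_def)
      also have "\<dots> = (norm (fst p - a))\<^sup>2 + (norm (snd p))\<^sup>2"
        by (cases p) (simp add: dist_norm norm_Pair norm_minus_commute[of a])
      also have "\<dots> \<le> f p"
        using assms(3) mult_right_mono[of 1 c "(norm (snd p))\<^sup>2"] by (simp add: f_def)
      finally show ?thesis .
    qed (rule q(2))
    then show "(norm (fst q - a))\<^sup>2 + c * (norm (snd q))\<^sup>2 \<le> (norm (fst p - a))\<^sup>2 + c * (norm (snd p))\<^sup>2"
      by (simp add: f_def)
  qed
qed

text \<open>Under the growing penalties \<open>Suc j\<close> the minimal values stay below the value
  at \<open>(z, 0)\<close>. This forces the second components to 0 and keeps the first ones in a
  ball, so some subsequence tends to a point \<open>(zs, 0)\<close> of \<open>G\<close>; a late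
  member of it is the required \<open>q\<close>.\<close>

lemma penalty_minimizers_accumulate:
  fixes G :: "('a::euclidean_space \<times> 'b::euclidean_space) set"
  assumes G: "closed G" "(z, 0) \<in> G" and e: "e > 0"
  obtains zs q c where "(zs, 0) \<in> G" "norm (zs - a) \<le> norm (z - a)" "q \<in> G" "dist q (zs, 0) < e"
    "(a - fst q, c *\<^sub>R snd q) \<in> regular_normal_cone G q"
proof -
  have "\<forall>j. \<exists>q\<in>G. \<forall>p\<in>G. (norm (fst q - a))\<^sup>2 + real (Suc j) * (norm (snd q))\<^sup>2
      \<le> (norm (fst p - a))\<^sup>2 + real (Suc j) * (norm (snd p))\<^sup>2"
  proof
    fix j
    show "\<exists>q\<in>G. \<forall>p\<in>G. (norm (fst q - a))\<^sup>2 + real (Suc j) * (norm (snd q))\<^sup>2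
      \<le> (norm (fst p - a))\<^sup>2 + real (Suc j) * (norm (snd p))\<^sup>2"
      by (rule penalty_minimizer_exists[OF G, of "real (Suc j)" a]) (simp, blast)
  qed
  then obtain q where q: "\<And>j. q j \<in> G"
    and min: "\<And>j p. p \<in> G \<Longrightarrow> (norm (fst (q j) - a))\<^sup>2 + real (Suc j) * (norm (snd (q j)))\<^sup>2
      \<le> (norm (fst p - a))\<^sup>2 + real (Suc j) * (norm (snd p))\<^sup>2"
    by metis
  define R where "R = norm (z - a)"
  have val: "(norm (fst (q j) - a))\<^sup>2 + real (Suc j) * (norm (snd (q j)))\<^sup>2 \<le> R\<^sup>2" for j
    using min[OF G(2), of j] by (simp add: R_def)
  have fstb: "norm (fst (q j) - a) \<le> R" for j
  proof (rule power2_le_imp_le)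
    have "0 \<le> real (Suc j) * (norm (snd (q j)))\<^sup>2" by simp
    then show "(norm (fst (q j) - a))\<^sup>2 \<le> R\<^sup>2" using val[of j] by linarith
  qed (simp add: R_def)
  have sndb: "(norm (snd (q j)))\<^sup>2 \<le> R\<^sup>2 * inverse (real (Suc j))" for j
  proof -
    have "real (Suc j) * (norm (snd (q j)))\<^sup>2 \<le> R\<^sup>2"
      using val[of j] zero_le_power2[of "norm (fst (q j) - a)"] by linarith
    then show ?thesis by (simp add: field_simps)
  qed
  have "(\<lambda>j. (norm (snd (q j)))\<^sup>2) \<longlonglongrightarrow> 0"
  proof (rule tendsto_sandwich[OF _ _ tendsto_const])
    show "(\<lambda>j. R\<^sup>2 * inverse (real (Suc j))) \<longlonglongrightarrow> 0"
      using tendsto_mult[OF tendsto_const[of "R\<^sup>2"] LIMSEQ_inverse_real_of_nat] by simp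
  qed (use sndb in auto)
  then have "(\<lambda>j. sqrt ((norm (snd (q j)))\<^sup>2)) \<longlonglongrightarrow> sqrt 0"
    by (rule tendsto_real_sqrt)
  then have snd0: "(\<lambda>j. snd (q j)) \<longlonglongrightarrow> 0"
    by (simp add: tendsto_norm_zero_iff)
  have "\<forall>j. fst (q j) \<in> cball a R"
    using fstb by (simp add: dist_norm norm_minus_commute)
  then obtain zs r where zs: "zs \<in> cball a R" and r: "strict_mono (r :: nat \<Rightarrow> nat)"
    and fl: "((\<lambda>j. fst (q j)) \<circ> r) \<longlonglongrightarrow> zs"
    using compact_cball[of a R] unfolding compact_def by metis
  have lim: "(\<lambda>j. q (r j)) \<longlonglongrightarrow> (zs, 0)"
    using tendsto_Pair[OF fl LIMSEQ_subseq_LIMSEQ[OF snd0 r]] by (simp add: o_def)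
  then obtain j where j: "dist (q (r j)) (zs, 0) < e"
    using tendstoD[OF lim e] by (auto simp: eventually_sequentially)
  show thesis
  proof (rule that)
    show "(zs, 0) \<in> G" using closed_sequentially[OF G(1) _ lim] q by blast
    show "norm (zs - a) \<le> norm (z - a)"
      using zs by (simp add: R_def dist_norm norm_minus_commute)
    \<comment> \<open>The witness for \<open>c\<close> is minus the penalty parameter.\<close>
    show "(a - fst (q (r j)), (- real (Suc (r j))) *\<^sub>R snd (q (r j))) \<in> regular_normal_cone G (q (r j))"
      by (rule regular_normal_cone_minimizer[OF q _ min]) auto
  qed (use q j in auto)
qed

lemma regular_normal_section_approx:
  fixes G :: "('a::euclidean_space \<times> 'b::euclidean_space) set"
  assumes G: "closed G" and v: "v \<in> regular_normal_cone {z. (z, 0) \<in> G} z" and e: "e > 0"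
  obtains q v' y where "q \<in> G" "dist q (z, 0) < e" "dist v' v < e" "(v', y) \<in> regular_normal_cone G q"
proof -
  \<comment> \<open>Along the points \<open>z + \<tau> v\<close> the nearest points of the section are \<open>z + o(\<tau>)\<close>, so the
    corresponding penalty normals, divided by \<open>\<tau>\<close>, are close to \<open>v\<close>.\<close>
  have z: "(z, 0) \<in> G" using v by (auto simp: regular_normal_cone_def split: if_splits)
  \<comment> \<open>The errors below add up to three times \<open>\<epsilon>\<close>: one from
    \<open>fst q - zs\<close> and two from \<open>zs - z\<close>.\<close>
  define \<epsilon> where "\<epsilon> = e / 4"
  have "\<epsilon> > 0" using e by (simp add: \<epsilon>_def)
  obtain d where d: "d > 0" and
    little: "\<And>y. y \<in> {z. (z, 0) \<in> G} \<Longrightarrow> dist y z < d \<Longrightarrow> v \<bullet> (y - z) \<le> \<epsilon> * norm (y - z)"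
    using regular_normal_cone_little_o[OF v \<open>\<epsilon> > 0\<close>] by blast
  \<comment> \<open>Small enough that \<open>2 * \<tau> * norm v < d\<close>, which puts
    \<open>zs\<close> within reach of the little-o bound.\<close>
  define \<tau> where "\<tau> = min 1 (d / (2 * norm v + 1))"
  have nv: "2 * norm v + 1 > 0" using norm_ge_zero[of v] by linarith
  have \<tau>: "\<tau> > 0" "\<tau> \<le> 1" using d nv by (auto simp: \<tau>_def)
  have "\<tau> * (2 * norm v + 1) \<le> d"
    using nv by (simp add: \<tau>_def flip: pos_le_divide_eq)
  then have \<tau>d: "2 * \<tau> * norm v < d" using \<tau> by (simp add: algebra_simps)
  define a where "a = z + \<tau> *\<^sub>R v"
  obtain zs q c where zs: "(zs, 0) \<in> G" "norm (zs - a) \<le> norm (z - a)"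
    and q: "q \<in> G" "dist q (zs, 0) < \<tau> * \<epsilon>" "(a - fst q, c *\<^sub>R snd q) \<in> regular_normal_cone G q"
    using penalty_minimizers_accumulate[OF G z mult_pos_pos[OF \<tau>(1) \<open>\<epsilon> > 0\<close>], of a] by blast
  have za: "norm (z - a) = \<tau> * norm v" using \<tau> by (simp add: a_def)
  have "norm (zs - z) \<le> norm (zs - a) + norm (z - a)"
    using norm_triangle_ineq4[of "zs - a" "z - a"] by simp
  then have "norm (zs - z) < d" using zs(2) za \<tau>d by linarith
  \<comment> \<open>Expanding the squares around \<open>z\<close> leaves
    \<open>(norm (zs - z))\<^sup>2\<close> against
    \<open>2 * \<tau> * (v \<bullet> (zs - z))\<close>. The little-o bound on the inner product and
    a cancellation then make \<open>norm (zs - z)\<close> small relative to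
    \<open>\<tau>\<close>.\<close>
  have "(norm (zs - a))\<^sup>2 \<le> (norm (z - a))\<^sup>2" by (rule power_mono[OF zs(2)]) simp
  then have "(norm (zs - z))\<^sup>2 \<le> 2 * \<tau> * (v \<bullet> (zs - z))"
    by (simp add: a_def power2_norm_eq_inner inner_commute power2_eq_square[of \<tau>] algebra_simps)
  also have "\<dots> \<le> 2 * \<tau> * (\<epsilon> * norm (zs - z))"
    using \<tau> zs(1) \<open>norm (zs - z) < d\<close> by (intro mult_left_mono little) (auto simp: dist_norm)
  finally have "norm (zs - z) * norm (zs - z) \<le> (2 * \<tau> * \<epsilon>) * norm (zs - z)"
    by (simp add: power2_eq_square algebra_simps)
  then have zsz: "norm (zs - z) \<le> 2 * \<tau> * \<epsilon>"
    using \<tau> \<open>\<epsilon> > 0\<close> by (cases "norm (zs - z) = 0") (auto simp: mult_le_cancel_right)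
  have fq: "norm (fst q - zs) < \<tau> * \<epsilon>"
    using q(2) dist_fst_le[of q "(zs, 0)"] by (simp add: dist_norm)
  show thesis
  proof (rule that)
    show "q \<in> G" by (rule q)
    have "dist q (z, 0) \<le> dist q (zs, 0) + dist (zs, 0::'b) (z, 0)" by (rule dist_triangle)
    also have "dist (zs, 0::'b) (z, 0) = norm (zs - z)" by (simp add: dist_Pair_Pair dist_norm)
    also have "dist q (zs, 0) + norm (zs - z) < 3 * (\<tau> * \<epsilon>)" using q(2) zsz by linarith
    also have "\<dots> \<le> 3 * (1 * \<epsilon>)" using \<tau> \<open>\<epsilon> > 0\<close> by (intro mult_left_mono mult_right_mono) auto
    finally show "dist q (z, 0) < e" using e by (simp add: \<epsilon>_def)
    have "inverse \<tau> *\<^sub>R (a - fst q, c *\<^sub>R snd q) \<in> regular_normal_cone G q"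
      using q(3) \<tau> by (intro regular_normal_cone_scale) auto
    then show "(inverse \<tau> *\<^sub>R (a - fst q), inverse \<tau> *\<^sub>R c *\<^sub>R snd q) \<in> regular_normal_cone G q"
      by simp
    have "inverse \<tau> *\<^sub>R (a - fst q) - v = inverse \<tau> *\<^sub>R (z - fst q)"
      using \<tau> by (simp add: a_def algebra_simps)
    then have "dist (inverse \<tau> *\<^sub>R (a - fst q)) v = norm (z - fst q) / \<tau>"
      using \<tau> by (simp add: dist_norm divide_inverse_commute)
    moreover have "norm (z - fst q) \<le> norm (fst q - zs) + norm (zs - z)"
      using norm_triangle_ineq[of "z - zs" "zs - fst q"] by (simp add: norm_minus_commute)
    then have "norm (z - fst q) < 3 * \<epsilon> * \<tau>" using fq zsz by (simp add: mult_ac)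
    then have "norm (z - fst q) / \<tau> < 3 * \<epsilon>" using \<tau> by (simp add: pos_divide_less_eq)
    ultimately show "dist (inverse \<tau> *\<^sub>R (a - fst q)) v < e"
      using e unfolding \<epsilon>_def by linarith
  qed
qed

text \<open>Extends the approximation from regular to limiting normals of the section. The
  components \<open>ys\<close> may still be unbounded; a constraint qualification controls them in
  the next lemma.\<close>

lemma normal_section_approx:
  fixes G :: "('a::euclidean_space \<times> 'b::euclidean_space) set"
  assumes G: "closed G" and v: "v \<in> normal_cone {z. (z, 0) \<in> G} z"
  obtains q vs ys where "\<And>k::nat. q k \<in> G" "\<And>k. (vs k, ys k) \<in> regular_normal_cone G (q k)"
    "q \<longlonglongrightarrow> (z, 0)" "vs \<longlonglongrightarrow> v"
proof -
  have "v \<in> outer_limit (\<lambda>q. fst ` regular_normal_cone G q) (z, 0) G"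
    unfolding outer_limit_iff
  proof (intro allI impI)
    fix e :: real assume "e > 0"
    moreover have "v \<in> outer_limit (regular_normal_cone {z. (z, 0) \<in> G}) z {z. (z, 0) \<in> G}"
      using v by (auto simp: normal_cone_def split: if_splits)
    ultimately obtain z' v' where z': "(z', 0) \<in> G" "v' \<in> regular_normal_cone {z. (z, 0) \<in> G} z'"
      "dist z' z < e/2" "dist v' v < e/2"
      unfolding outer_limit_iff by (metis half_gt_zero mem_Collect_eq)
    obtain q v'' y where q: "q \<in> G" "dist q (z', 0) < e/2" "dist v'' v' < e/2"
      "(v'', y) \<in> regular_normal_cone G q"
      by (rule regular_normal_section_approx[OF G z'(2) half_gt_zero[OF \<open>e > 0\<close>]])
    have "dist (z', 0::'b) (z, 0) < e/2" using z' by (simp add: dist_Pair_Pair)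
    then have "dist q (z, 0) < e" using q(2) dist_triangle[of q "(z, 0)" "(z', 0)"] by linarith
    moreover have "dist v'' v < e" using q(3) z'(4) dist_triangle[of v'' v v'] by linarith
    ultimately show "\<exists>q\<in>G. \<exists>v'\<in>fst ` regular_normal_cone G q. dist q (z, 0) < e \<and> dist v' v < e"
      using q(1,4) by force
  qed
  then obtain q vs where q: "\<And>k::nat. q k \<in> G" "\<And>k. vs k \<in> fst ` regular_normal_cone G (q k)"
    and "q \<longlonglongrightarrow> (z, 0)" "vs \<longlonglongrightarrow> v"
    unfolding outer_limit_def by auto
  have "\<forall>k. \<exists>y. (vs k, y) \<in> regular_normal_cone G (q k)" using q(2) by force
  then obtain ys where "\<And>k. (vs k, ys k) \<in> regular_normal_cone G (q k)" by metis
  with q \<open>q \<longlonglongrightarrow> _\<close> \<open>vs \<longlonglongrightarrow> v\<close> show thesis using that by blast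
qed

text \<open>The qualification is what \<open>outer_limit_cone_lift\<close> asks of the regular
  normals of \<open>G\<close>; it turns the approximating pairs into a convergent choice of second
  components.\<close>

lemma normal_cone_section:
  fixes G :: "('a::euclidean_space \<times> 'b::euclidean_space) set"
  assumes G: "closed G" and v: "v \<in> normal_cone {z. (z, 0) \<in> G} z"
    and cq: "\<And>y. (0, y) \<in> normal_cone G (z, 0) \<Longrightarrow> y = 0"
  obtains y where "(v, y) \<in> normal_cone G (z, 0)"
proof -
  have z: "(z, 0) \<in> G" using v by (auto simp: normal_cone_def split: if_splits)
  obtain q vs ys where q: "\<And>k::nat. q k \<in> G" "\<And>k. (vs k, ys k) \<in> regular_normal_cone G (q k)"
    "q \<longlonglongrightarrow> (z, 0)" "vs \<longlonglongrightarrow> v"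
    using normal_section_approx[OF G v] by blast
  obtain y where "(v, y) \<in> outer_limit (regular_normal_cone G) (z, 0) G"
  proof (rule outer_limit_cone_lift[of "regular_normal_cone G" "(z, 0)" G q vs ys v])
    show "y = 0" if "(0, y) \<in> outer_limit (regular_normal_cone G) (z, 0) G" for y
      using that cq z by (simp add: normal_cone_def)
  qed (use q in \<open>auto intro: regular_normal_cone_scale less_imp_le\<close>)
  then show thesis using that z by (simp add: normal_cone_def)
qed

text \<open>Violations at points arbitrarily far along the sequence could be scaled to
  \<open>norm y = 1\<close>; by compactness and outer semicontinuity a unit violation would survive
  at \<open>z\<close>.\<close>

lemma constraint_qualification_nearby:
  fixes G :: "('a::euclidean_space \<times> 'b::euclidean_space) set"
  assumes z: "(z, 0) \<in> G" and cq: "\<And>y. (0, y) \<in> normal_cone G (z, 0) \<Longrightarrow> y = 0"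
    and zs: "zs \<longlonglongrightarrow> z"
  shows "\<forall>\<^sub>F k::nat in sequentially. \<forall>y. (0, y) \<in> normal_cone G (zs k, 0) \<longrightarrow> y = 0"
proof (rule ccontr)
  assume "\<not> ?thesis"
  then have "\<exists>\<^sub>F k in sequentially. \<exists>y. (0, y) \<in> normal_cone G (zs k, 0) \<and> y \<noteq> 0"
    by (simp add: not_eventually)
  then have "\<forall>n. \<exists>k\<ge>n. \<exists>y. (0, y) \<in> normal_cone G (zs k, 0) \<and> y \<noteq> 0"
    by (simp add: frequently_sequentially)
  \<comment> \<open>\<open>r\<close> is not claimed to be increasing; \<open>r n \<ge> n\<close>
    already makes it tend to infinity.\<close>
  then obtain r y where r: "\<And>n. r n \<ge> n" "\<And>n. (0, y n) \<in> normal_cone G (zs (r n), 0)" "\<And>n. y n \<noteq> 0"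
    by metis
  have "filterlim r at_top sequentially"
    using r(1) by (intro filterlim_at_top_mono[OF filterlim_ident]) auto
  then have zr: "(\<lambda>n. zs (r n)) \<longlonglongrightarrow> z" by (rule filterlim_compose[OF zs])
  have unit: "(0, sgn (y n)) \<in> normal_cone G (zs (r n), 0)" for n
    using normal_cone_scale[OF r(2), of "inverse (norm (y n))" n] by (simp add: sgn_div_norm)
  have "\<forall>n. sgn (y n) \<in> sphere 0 1" using r(3) by (simp add: norm_sgn)
  then obtain l \<rho> where l: "l \<in> sphere 0 1" "strict_mono \<rho>" "((\<lambda>n. sgn (y n)) \<circ> \<rho>) \<longlonglongrightarrow> l"
    using compact_sphere[of "0::'b" 1] unfolding compact_def by metis
  have "(0, l) \<in> normal_cone G (z, 0)"
  proof (rule normal_cone_outer_semicontinuous)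
    show "(\<lambda>k. (zs (r (\<rho> k)), 0)) \<longlonglongrightarrow> (z, 0)"
      using LIMSEQ_subseq_LIMSEQ[OF zr l(2)] by (intro tendsto_Pair) (auto simp: o_def)
    show "(\<lambda>k. (0, sgn (y (\<rho> k)))) \<longlonglongrightarrow> (0, l)"
      using l(3) by (intro tendsto_Pair) (auto simp: o_def)
  qed (use unit z in auto)
  then have "l = 0" by (rule cq)
  then show False using l(1) by simp
qed

section \<open>Tangent spaces of smooth manifolds\<close>

text \<open>Full rank is expressed by the dimension of an image set, which hides repetitions.
  Counting first shows that the family is injective, and only then does independence of the set
  apply to the indexed sum.\<close>

lemma independent_family_coefficients:
  fixes h :: "nat \<Rightarrow> 'a::euclidean_space"
  assumes dim: "dim (h ` {..<n}) = n" and sum: "(\<Sum>i<n. c i *\<^sub>R h i) = 0" and i: "i < n"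
  shows "c i = 0"
proof -
  have fin: "finite (h ` {..<n})" by simp
  have "n \<le> card (h ` {..<n})" using dim_le_card'[OF fin] dim by simp
  then have card: "card (h ` {..<n}) = n" using card_image_le[of "{..<n}" h] by simp
  then have inj: "inj_on h {..<n}" by (intro eq_card_imp_inj_on) auto
  have ind: "independent (h ` {..<n})"
    by (rule card_le_dim_spanning[OF subset_refl span_superset fin]) (simp add: card dim)
  have "(\<Sum>v\<in>h ` {..<n}. c (the_inv_into {..<n} h v) *\<^sub>R v) = 0"
    using sum by (simp add: sum.reindex[OF inj] the_inv_into_f_f[OF inj] cong: sum.cong_simp)
  then have "c (the_inv_into {..<n} h (h i)) = 0"
    using i by (intro independentD[OF ind fin subset_refl]) auto
  then show ?thesis using i by (simp add: the_inv_into_f_f[OF inj])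
qed

text \<open>Both \<open>w\<close> and \<open>w + t k *\<^sub>R ws k\<close> are zeros of
  \<open>\<phi>\<close> for late \<open>k\<close>, so the first-order term equals the remainder up
  to sign and vanishes after division by \<open>t k\<close>.\<close>

lemma tangent_cone_differentiable_equation:
  fixes \<phi> :: "'a::euclidean_space \<Rightarrow> real"
  assumes D: "GDERIV \<phi> w :> d" and U: "open U" "w \<in> U" and zero: "\<And>z. z \<in> W \<inter> U \<Longrightarrow> \<phi> z = 0"
    and p: "p \<in> tangent_cone W w"
  shows "d \<bullet> p = 0"
  using p
proof (rule tangent_coneE)
  fix t ws
  assume *: "w \<in> W" "\<And>k::nat. t k > 0" "\<And>k. w + t k *\<^sub>R ws k \<in> W" "t \<longlonglongrightarrow> 0" "ws \<longlonglongrightarrow> p"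
  have der: "(\<phi> has_derivative (\<lambda>h. h \<bullet> d)) (at w)" using D by (simp add: gderiv_def)
  define R where "R h = \<phi> (w + h) - \<phi> w - h \<bullet> d" for h
  have R: "((\<lambda>h. norm (R h) / norm h) \<longlongrightarrow> 0) (at 0)"
    using der by (simp add: has_derivative_at R_def)
  have lim: "(\<lambda>k. t k *\<^sub>R ws k) \<longlonglongrightarrow> 0"
    using tendsto_scaleR[OF *(4,5)] by simp
  have "(\<lambda>k. w + t k *\<^sub>R ws k) \<longlonglongrightarrow> w + 0" by (intro tendsto_intros lim)
  then have inU: "\<forall>\<^sub>F k in sequentially. w + t k *\<^sub>R ws k \<in> U"
    using topological_tendstoD U by fastforce
  \<comment> \<open>At \<open>h = 0\<close> the quotient is 0 by the convention for division, so the
    limit holds in the full neighbourhood filter. This admits indices with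
    \<open>ws k = 0\<close>.\<close>
  have R': "((\<lambda>h. norm (R h) / norm h) \<longlongrightarrow> 0) (nhds 0)"
    using R tendsto_nhds_iff[of "\<lambda>h. norm (R h) / norm h" 0 0] by (simp add: R_def)
  have "(\<lambda>k. norm (R (t k *\<^sub>R ws k)) / norm (t k *\<^sub>R ws k) * norm (ws k)) \<longlonglongrightarrow> 0 * norm p"
    by (intro tendsto_intros * filterlim_compose[OF R' lim])
  moreover have "\<forall>\<^sub>F k in sequentially.
      norm (R (t k *\<^sub>R ws k)) / norm (t k *\<^sub>R ws k) * norm (ws k) = \<bar>ws k \<bullet> d\<bar>"
    using inU
  proof eventually_elim
    case (elim k)
    have "R (t k *\<^sub>R ws k) = - (t k * (ws k \<bullet> d))"
      using zero[of w] zero[of "w + t k *\<^sub>R ws k"] elim * U by (simp add: R_def)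
    then show ?case
      using *(2)[of k] by (cases "ws k = 0") (auto simp: abs_mult)
  qed
  ultimately have "(\<lambda>k. \<bar>ws k \<bullet> d\<bar>) \<longlonglongrightarrow> 0"
    by (simp add: tendsto_cong)
  moreover have "(\<lambda>k. \<bar>ws k \<bullet> d\<bar>) \<longlonglongrightarrow> \<bar>p \<bullet> d\<bar>" by (intro tendsto_intros *)
  ultimately have "\<bar>p \<bullet> d\<bar> = 0" using LIMSEQ_unique by blast
  then show ?thesis by (simp add: inner_commute)
qed

lemma tangent_cone_derivative:
  assumes D: "(\<gamma> has_vector_derivative p) (at (0::real))" and d: "d > 0"
    and mem: "\<And>s. 0 \<le> s \<Longrightarrow> s < d \<Longrightarrow> \<gamma> s \<in> W"
  shows "p \<in> tangent_cone W (\<gamma> 0)"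
proof (rule tangent_coneI)
  \<comment> \<open>The double successor keeps \<open>t 0\<close> strictly below
    \<open>d\<close>.\<close>
  define t where "t k = d * inverse (real (Suc (Suc k)))" for k
  have t: "0 < t k" "t k < d" for k using d by (auto simp: t_def field_simps add_pos_nonneg)
  show "t \<longlonglongrightarrow> 0"
    unfolding t_def
    using tendsto_mult[OF tendsto_const[of d] LIMSEQ_Suc[OF LIMSEQ_inverse_real_of_nat]] by simp
  then have "filterlim t (at 0) sequentially"
    using t(1) by (intro filterlim_atI always_eventually) (auto simp: less_imp_neq[symmetric])
  moreover have "((\<lambda>s. (\<gamma> s - \<gamma> 0) /\<^sub>R s) \<longlongrightarrow> p) (at 0)"
  proof (rule LIM_zero_cancel, rule tendsto_norm_zero_cancel, rule Lim_transform_eventually)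
    show "((\<lambda>s. norm (\<gamma> s - \<gamma> 0 - (s - 0) *\<^sub>R p) / norm (s - 0)) \<longlongrightarrow> 0) (at 0)"
      using D unfolding has_vector_derivative_def has_derivative_iff_norm by simp
    show "\<forall>\<^sub>F s in at 0. norm (\<gamma> s - \<gamma> 0 - (s - 0) *\<^sub>R p) / norm (s - 0)
        = norm ((\<gamma> s - \<gamma> 0) /\<^sub>R s - p)"
      unfolding eventually_at_filter
    proof (intro always_eventually allI impI)
      fix s :: real assume "s \<noteq> 0"
      then have "(\<gamma> s - \<gamma> 0) /\<^sub>R s - p = (\<gamma> s - \<gamma> 0 - (s - 0) *\<^sub>R p) /\<^sub>R s"
        by (simp add: scaleR_diff_right)
      then show "norm (\<gamma> s - \<gamma> 0 - (s - 0) *\<^sub>R p) / norm (s - 0) = norm ((\<gamma> s - \<gamma> 0) /\<^sub>R s - p)"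
        by (simp add: divide_inverse_commute)
    qed
  qed
  ultimately show "(\<lambda>k. (\<gamma> (t k) - \<gamma> 0) /\<^sub>R t k) \<longlonglongrightarrow> p"
    by (rule filterlim_compose[rotated])
  show "\<gamma> 0 \<in> W" using mem d by simp
  show "0 < t k" "\<gamma> 0 + t k *\<^sub>R ((\<gamma> (t k) - \<gamma> 0) /\<^sub>R t k) \<in> W" for k
    using t[of k] mem[of "t k"] by auto
qed

text \<open>The kernel description is obtained at all points of \<open>W\<close> near
  \<open>wbar\<close>, although the rank is prescribed only at \<open>wbar\<close>; the inverse
  function theorem spreads it. One inclusion differentiates the equations, the other needs a curve
  in \<open>W\<close> with prescribed velocity.\<close>

lemma tangent_cone_smooth_manifold:
  fixes W :: "'a::euclidean_space set"
  assumes "smooth_manifold_at W wbar"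
  obtains U n g where "open U" "wbar \<in> U" "\<And>i::nat. i < n \<Longrightarrow> continuous_on U (g i)"
    "\<And>w. w \<in> W \<inter> U \<Longrightarrow> tangent_cone W w = {p. \<forall>i<n. g i w \<bullet> p = 0}"
proof -
  obtain d' U \<Phi> g where U: "open U" "wbar \<in> U"
    and D: "\<And>i w. i < DIM('a) - d' \<Longrightarrow> w \<in> U \<Longrightarrow> GDERIV (\<Phi> i) w :> g i w"
    and cont: "\<And>i. i < DIM('a) - d' \<Longrightarrow> continuous_on U (g i)"
    and dim: "dim ((\<lambda>i. g i wbar) ` {..< DIM('a) - d'}) = DIM('a) - d'"
    and W: "W \<inter> U = {w \<in> U. \<forall>i < DIM('a) - d'. \<Phi> i w = 0}" and wbar: "wbar \<in> W"
    using assms unfolding smooth_manifold_at_def smooth_manifold_of_dim_at_def by blast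
  define n where "n = DIM('a) - d'"
  define h where "h i = g i wbar" for i
  define N where "N = span (h ` {..<n})"
  obtain B where B: "B \<subseteq> N\<^sup>\<bottom>" "independent B" "N\<^sup>\<bottom> \<subseteq> span B"
    using basis_exists[of "N\<^sup>\<bottom>"] by metis
  have finB: "finite B" using B(2) by (rule independent_imp_finite)
  \<comment> \<open>\<open>F\<close> straightens \<open>W\<close>: it is a local diffeomorphism at \<open>wbar\<close>, and \<open>\<Phi> = 0\<close> exactly
    where the \<open>N\<close>-component of \<open>F\<close> vanishes.\<close>
  define P where "P z = (\<Sum>b\<in>B. (z \<bullet> b) *\<^sub>R b)" for z
  define F where "F z = P z + (\<Sum>i<n. \<Phi> i z *\<^sub>R h i)" for z
  define F' where "F' z = (\<Sum>b\<in>B. blinfun_scaleR_left b o\<^sub>L blinfun_inner_right b) +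
      (\<Sum>i<n. blinfun_scaleR_left (h i) o\<^sub>L blinfun_inner_right (g i z))" for z
  have P_lin: "linear P"
    unfolding P_def by (intro linearI) (auto simp: inner_add_left scaleR_add_left sum.distrib scaleR_sum_right)
  have P_range: "P z \<in> N\<^sup>\<bottom>" for z
    unfolding P_def using B(1)
    by (intro subspace_sum subspace_orthogonal_comp subspace_scale) auto
  have F': "blinfun_apply (F' z) p = P p + (\<Sum>i<n. (p \<bullet> g i z) *\<^sub>R h i)" for z p
    by (simp add: F'_def P_def blinfun.add_left blinfun.sum_left inner_commute)
  have derF: "(F has_derivative blinfun_apply (F' z)) (at z)" if "z \<in> U" for z
  proof -
    have "(\<Phi> i has_derivative (\<lambda>p. p \<bullet> g i z)) (at z)" if "i < n" for i
      using D[of i z] that \<open>z \<in> U\<close> by (simp add: n_def gderiv_def)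
    then have "(F has_derivative (\<lambda>p. P p + (\<Sum>i<n. (p \<bullet> g i z) *\<^sub>R h i))) (at z)"
      unfolding F_def P_def by (auto intro!: derivative_eq_intros)
    moreover have "blinfun_apply (F' z) = (\<lambda>p. P p + (\<Sum>i<n. (p \<bullet> g i z) *\<^sub>R h i))"
      by (rule ext) (rule F')
    ultimately show ?thesis by simp
  qed
  have contF: "continuous_on U F'"
    unfolding F'_def using cont by (auto intro!: continuous_intros simp: n_def)
  \<comment> \<open>Pairing the derivative with \<open>p\<close> itself gives a sum of squares. A
    kernel vector is thus orthogonal to every \<open>h i\<close>, hence lies in
    \<open>N\<^sup>\<bottom>\<close>, and it is also orthogonal to the basis \<open>B\<close> of
    that space.\<close>
  have "p = 0" if "blinfun_apply (F' wbar) p = 0" for p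
  proof -
    have "0 = p \<bullet> blinfun_apply (F' wbar) p" using that by simp
    also have "\<dots> = (\<Sum>b\<in>B. (p \<bullet> b)\<^sup>2) + (\<Sum>i<n. (p \<bullet> h i)\<^sup>2)"
      unfolding F' P_def h_def by (simp add: inner_add_right inner_sum_right power2_eq_square)
    finally have "(\<Sum>b\<in>B. (p \<bullet> b)\<^sup>2) = 0 \<and> (\<Sum>i<n. (p \<bullet> h i)\<^sup>2) = 0"
      using add_nonneg_eq_0_iff[of "\<Sum>b\<in>B. (p \<bullet> b)\<^sup>2" "\<Sum>i<n. (p \<bullet> h i)\<^sup>2"]
      by (simp add: sum_nonneg)
    then have B0: "\<And>b. b \<in> B \<Longrightarrow> p \<bullet> b = 0" and h0: "\<And>i. i < n \<Longrightarrow> p \<bullet> h i = 0"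
      using finB by (auto simp: sum_nonneg_eq_0_iff)
    have "orthogonal p a" if "a \<in> N" for a
      using that unfolding N_def by (rule orthogonal_to_span) (use h0 in \<open>auto simp: orthogonal_def\<close>)
    then have "p \<in> N\<^sup>\<bottom>" by (auto simp: orthogonal_comp_def orthogonal_commute)
    then have "p \<in> span B" using B(3) by auto
    then have "orthogonal p p"
      by (rule orthogonal_to_span) (use B0 in \<open>auto simp: orthogonal_def\<close>)
    then show ?thesis by (simp add: orthogonal_self)
  qed
  then have "inj (blinfun_apply (F' wbar))"
    by (intro linear_injective_0[THEN iffD2] bounded_linear.linear[OF blinfun.bounded_linear_right]) blast
  then obtain f where f: "linear f" "f \<circ> blinfun_apply (F' wbar) = id"
    using linear_injective_left_inverse bounded_linear.linear[OF blinfun.bounded_linear_right] by blast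
  have inv: "Blinfun f o\<^sub>L F' wbar = id_blinfun"
  proof (rule blinfun_eqI)
    fix p
    show "blinfun_apply (Blinfun f o\<^sub>L F' wbar) p = blinfun_apply id_blinfun p"
      using f(1) fun_cong[OF f(2), of p] by (simp add: bounded_linear_Blinfun_apply linear_conv_bounded_linear)
  qed
  show thesis
  proof (rule inverse_function_theorem[OF U(1) derF contF U(2) inv])
    fix U' V \<gamma> \<gamma>'
    assume U': "open U'" "U' \<subseteq> U" "wbar \<in> U'" and V: "open V"
      and hom: "homeomorphism U' V F \<gamma>"
      and \<gamma>: "\<And>y. y \<in> V \<Longrightarrow> (\<gamma> has_derivative \<gamma>' y) (at y)"
      and \<gamma>': "\<And>y. y \<in> V \<Longrightarrow> \<gamma>' y = Hilbert_Choice.inv (blinfun_apply (F' (\<gamma> y)))"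
      and bij: "\<And>y. y \<in> V \<Longrightarrow> bij (blinfun_apply (F' (\<gamma> y)))"
    have tangent: "p \<in> tangent_cone W w" if w: "w \<in> W \<inter> U'" and p: "\<And>i. i < n \<Longrightarrow> g i w \<bullet> p = 0" for w p
    proof -
      have "F w \<in> V" using w hom by (auto simp: homeomorphism_def)
      have \<gamma>w: "\<gamma> (F w) = w" using w hom by (simp add: homeomorphism_apply1)
      have \<Phi>w: "\<Phi> i w = 0" if "i < n" for i using w U'(2) W that by (auto simp: n_def)
      \<comment> \<open>Along this curve \<open>F\<close> moves straight in a direction of
        \<open>N\<^sup>\<bottom>\<close>, so its \<open>N\<close>-component remains 0 and the curve
        stays in \<open>W\<close>. Its velocity at 0 is \<open>p\<close>, because the derivative of
        \<open>F\<close> at \<open>w\<close> maps \<open>p\<close> to \<open>P p\<close> when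
        \<open>p\<close> is orthogonal to the gradients.\<close>
      define c where "c s = \<gamma> (F w + s *\<^sub>R P p)" for s :: real
      obtain e where e: "e > 0" "ball (F w) e \<subseteq> V"
        using V \<open>F w \<in> V\<close> open_contains_ball by blast
      \<comment> \<open>The added 1 covers the case \<open>P p = 0\<close>.\<close>
      define d where "d = e / (norm (P p) + 1)"
      have np: "norm (P p) + 1 > 0" using norm_ge_zero[of "P p"] by linarith
      then have "d > 0" using e by (simp add: d_def)
      have inV: "F w + s *\<^sub>R P p \<in> V" if s: "0 \<le> s" "s < d" for s
      proof -
        have "s * norm (P p) \<le> s * (norm (P p) + 1)" using s by (intro mult_left_mono) auto
        also have "\<dots> < e" using s np by (simp add: d_def pos_less_divide_eq)
        finally show ?thesis using e(2) s by (auto simp: dist_norm)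
      qed
      have "c s \<in> W" if s: "0 \<le> s" "s < d" for s
      proof -
        have cU: "c s \<in> U'" using inV[OF s] hom by (auto simp: c_def homeomorphism_def)
        have "F (c s) = F w + s *\<^sub>R P p"
          unfolding c_def by (rule homeomorphism_apply2[OF hom inV[OF s]])
        \<comment> \<open>The left side belongs to \<open>N\<close> and the right side to
          \<open>N\<^sup>\<bottom>\<close>, so the sum is orthogonal to itself.\<close>
        then have "(\<Sum>i<n. \<Phi> i (c s) *\<^sub>R h i) = P (w + s *\<^sub>R p - c s)"
          by (simp add: F_def \<Phi>w linear_add[OF P_lin] linear_diff[OF P_lin] linear_scale[OF P_lin] algebra_simps)
        then have "(\<Sum>i<n. \<Phi> i (c s) *\<^sub>R h i) \<in> N\<^sup>\<bottom>" using P_range by simp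
        moreover have "(\<Sum>i<n. \<Phi> i (c s) *\<^sub>R h i) \<in> N"
          unfolding N_def by (intro span_sum span_scale span_base) auto
        ultimately have "orthogonal (\<Sum>i<n. \<Phi> i (c s) *\<^sub>R h i) (\<Sum>i<n. \<Phi> i (c s) *\<^sub>R h i)"
          unfolding orthogonal_comp_def by blast
        then have "(\<Sum>i<n. \<Phi> i (c s) *\<^sub>R h i) = 0" by (simp add: orthogonal_self)
        then have "\<Phi> i (c s) = 0" if "i < n" for i
          using independent_family_coefficients[of h n "\<lambda>i. \<Phi> i (c s)" i] dim that
          by (simp add: n_def h_def)
        then show ?thesis using cU U'(2) W by (auto simp: n_def)
      qed
      moreover have "(c has_vector_derivative p) (at 0)"
      proof -
        have "(\<gamma> has_derivative \<gamma>' (F w)) (at (F w + 0 *\<^sub>R P p))" using \<gamma>[OF \<open>F w \<in> V\<close>] by simp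
        moreover have "((\<lambda>s. F w + s *\<^sub>R P p) has_derivative (\<lambda>s. s *\<^sub>R P p)) (at 0)"
          by (auto intro!: derivative_eq_intros)
        ultimately have "((\<lambda>s. \<gamma> (F w + s *\<^sub>R P p)) has_derivative (\<lambda>s. \<gamma>' (F w) (s *\<^sub>R P p))) (at 0)"
          by (rule has_derivative_compose[rotated])
        moreover have "\<gamma>' (F w) (s *\<^sub>R P p) = s *\<^sub>R p" for s
        proof -
          have "blinfun_apply (F' w) (s *\<^sub>R p) = s *\<^sub>R P p"
            using p by (simp add: F' linear_scale[OF P_lin] inner_commute)
          then have "s *\<^sub>R P p = blinfun_apply (F' (\<gamma> (F w))) (s *\<^sub>R p)" by (simp add: \<gamma>w)
          then show ?thesis
            using bij[OF \<open>F w \<in> V\<close>] by (simp only: \<gamma>'[OF \<open>F w \<in> V\<close>] inv_f_f[OF bij_is_inj])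
        qed
        ultimately show ?thesis
          unfolding has_vector_derivative_def c_def by simp
      qed
      ultimately have "p \<in> tangent_cone W (c 0)"
        using \<open>d > 0\<close> by (intro tangent_cone_derivative) auto
      then show ?thesis by (simp add: c_def \<gamma>w)
    qed
    show thesis
    proof (rule that[OF U'(1,3)])
      show "continuous_on U' (g i)" if "i < n" for i
        using cont[of i] that U'(2) by (auto simp: n_def intro: continuous_on_subset)
      fix w assume w: "w \<in> W \<inter> U'"
      have "g i w \<bullet> p = 0" if "p \<in> tangent_cone W w" "i < n" for p i
        using w U'(2) U(1) W that
        by (intro tangent_cone_differentiable_equation[of "\<Phi> i" w "g i w" U W p] D) (auto simp: n_def)
      then show "tangent_cone W w = {p. \<forall>i<n. g i w \<bullet> p = 0}"
        using tangent[OF w] by blast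
    qed
  qed
qed

section \<open>Projected normals over a smooth manifold\<close>

text \<open>The residual \<open>v - t\<close> of the projection is orthogonal to the tangent space
  and so is a combination of the gradients at \<open>w\<close>. The same coefficients applied to the
  gradients at other points define \<open>\<nu>\<close>.\<close>

lemma continuous_normal_field:
  assumes T: "\<And>w. w \<in> W \<inter> U \<Longrightarrow> tangent_cone W w = {p. \<forall>i<n. g i w \<bullet> p = 0}"
    and cont: "\<And>i::nat. i < n \<Longrightarrow> continuous_on U (g i)"
    and w: "w \<in> W \<inter> U" and t: "t \<in> projection (tangent_cone W w) v"
  obtains \<nu> where "continuous_on U \<nu>" "\<nu> w = v - t"
    "\<And>z p. z \<in> W \<inter> U \<Longrightarrow> p \<in> tangent_cone W z \<Longrightarrow> \<nu> z \<bullet> p = 0"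
proof -
  define A where "A = (\<lambda>i. g i w) ` {..<n}"
  have K: "tangent_cone W w = A\<^sup>\<bottom>"
    unfolding T[OF w] A_def orthogonal_comp_def orthogonal_def by auto
  have tK: "t \<in> A\<^sup>\<bottom>" and min: "\<forall>z\<in>A\<^sup>\<bottom>. dist v t \<le> dist v z"
    using t by (auto simp: mem_projection_iff K dist_norm norm_minus_commute)
  have sub: "subspace (A\<^sup>\<bottom>)" by (rule subspace_orthogonal_comp)
  \<comment> \<open>The variational inequality of the projection, tested at \<open>t + p\<close> and
    \<open>t - p\<close>, becomes an equality because the cone is a subspace.\<close>
  have "(v - t) \<bullet> p = 0" if p: "p \<in> A\<^sup>\<bottom>" for p
  proof -
    have "(v - t) \<bullet> (t + p - t) \<le> 0" "(v - t) \<bullet> (t - p - t) \<le> 0"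
      by (rule any_closest_point_dot[OF subspace_imp_convex[OF sub] closed_subspace[OF sub] tK _ min];
          use sub tK p in \<open>auto intro: subspace_add subspace_diff\<close>)+
    then show ?thesis by simp
  qed
  moreover have "(span A)\<^sup>\<bottom> = A\<^sup>\<bottom>"
  proof
    show "(span A)\<^sup>\<bottom> \<subseteq> A\<^sup>\<bottom>" by (rule orthogonal_comp_anti_mono) (rule span_superset)
    show "A\<^sup>\<bottom> \<subseteq> (span A)\<^sup>\<bottom>"
      unfolding orthogonal_comp_def by (auto simp: orthogonal_commute intro: orthogonal_to_span)
  qed
  ultimately have "v - t \<in> (span A)\<^sup>\<bottom>\<^sup>\<bottom>"
    by (auto simp: orthogonal_comp_def orthogonal_def inner_commute)
  then have "v - t \<in> span A" by (simp add: orthogonal_comp_self)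
  \<comment> \<open>Induction over the span builds the field one gradient at a time.\<close>
  then have "\<exists>\<nu>. continuous_on U \<nu> \<and> \<nu> w = v - t \<and>
      (\<forall>z\<in>W \<inter> U. \<forall>p\<in>tangent_cone W z. \<nu> z \<bullet> p = 0)"
  proof (induction rule: span_induct_alt)
    case base
    show ?case by (rule exI[of _ "\<lambda>_. 0"]) auto
  next
    case (step c x y)
    then obtain i \<nu> where i: "i < n" "x = g i w" and \<nu>: "continuous_on U \<nu>" "\<nu> w = y"
      "\<forall>z\<in>W \<inter> U. \<forall>p\<in>tangent_cone W z. \<nu> z \<bullet> p = 0"
      by (auto simp: A_def)
    show ?case
    proof (intro exI conjI)
      show "continuous_on U (\<lambda>z. c *\<^sub>R g i z + \<nu> z)"
        by (intro continuous_intros cont i \<nu>)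
      show "\<forall>z\<in>W \<inter> U. \<forall>p\<in>tangent_cone W z. (c *\<^sub>R g i z + \<nu> z) \<bullet> p = 0"
        using T i \<nu>(3) by (auto simp: inner_add_left)
    qed (simp add: i \<nu>)
  qed
  then show thesis using that by blast
qed

text \<open>The field \<open>\<nu>\<close> is subtracted from the first components of the regular
  normals approximating the given one. Tangents of \<open>G\<close> project to tangents of
  \<open>W\<close>, on which \<open>\<nu>\<close> vanishes, so the corrected vectors remain regular
  normals, and by continuity the limit has \<open>t\<close> in place of \<open>v\<close>.\<close>

lemma normal_cone_project_tangent:
  fixes G :: "(('a::euclidean_space \<times> 'b::euclidean_space) \<times> 'c::euclidean_space) set"
  assumes GW: "\<And>q. q \<in> G \<Longrightarrow> fst (fst q) \<in> W"
    and T: "\<And>w. w \<in> W \<inter> U \<Longrightarrow> tangent_cone W w = {p. \<forall>i<n. g i w \<bullet> p = 0}"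
    and cont: "\<And>i::nat. i < n \<Longrightarrow> continuous_on U (g i)"
    and U: "open U" "fst (fst q) \<in> U"
    and v: "((v, s), y) \<in> normal_cone G q" and t: "t \<in> projection (tangent_cone W (fst (fst q))) v"
  shows "((t, s), y) \<in> normal_cone G q"
proof -
  have q: "q \<in> G" and "((v, s), y) \<in> outer_limit (regular_normal_cone G) q G"
    using v by (auto simp: normal_cone_def split: if_splits)
  then obtain z p where z: "\<And>k::nat. z k \<in> G" "\<And>k. p k \<in> regular_normal_cone G (z k)"
    and zlim: "z \<longlonglongrightarrow> q" and plim: "p \<longlonglongrightarrow> ((v, s), y)"
    unfolding outer_limit_def by auto
  obtain \<nu> where \<nu>: "continuous_on U \<nu>" "\<nu> (fst (fst q)) = v - t"
    "\<And>z p. z \<in> W \<inter> U \<Longrightarrow> p \<in> tangent_cone W z \<Longrightarrow> \<nu> z \<bullet> p = 0"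
    using continuous_normal_field[OF T cont _ t] GW[OF q] U(2) by blast
  define w where "w k = fst (fst (z k))" for k
  have wlim: "w \<longlonglongrightarrow> fst (fst q)" unfolding w_def by (intro tendsto_fst zlim)
  then have "\<forall>\<^sub>F k in sequentially. w k \<in> U" using U by (rule topological_tendstoD)
  then obtain N where N: "\<And>k. k \<ge> N \<Longrightarrow> w k \<in> U" by (auto simp: eventually_sequentially)
  define r where "r k = p k - ((\<nu> (w k), 0), 0)" for k
  have reg: "r k \<in> regular_normal_cone G (z k)" if "k \<ge> N" for k
  proof -
    have "r k \<bullet> d \<le> 0" if d: "d \<in> tangent_cone G (z k)" for d
    proof -
      have "fst (fst d) \<in> tangent_cone W (0 + fst (fst (z k)))"
        by (rule tangent_cone_linear_image[OF _ _ d])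
          (auto intro!: bounded_linear_compose[OF bounded_linear_fst bounded_linear_fst] GW)
      then have "\<nu> (w k) \<bullet> fst (fst d) = 0"
        using N[OF \<open>k \<ge> N\<close>] GW[OF z(1)] by (intro \<nu>(3)) (auto simp: w_def)
      moreover have "p k \<bullet> d \<le> 0"
        using z(2)[of k] d by (auto simp: regular_normal_cone_def polar_cone_def split: if_splits)
      ultimately show ?thesis
        by (cases d) (auto simp: r_def inner_diff_left inner_Pair)
    qed
    then show ?thesis using z(1) by (simp add: regular_normal_cone_def polar_cone_def)
  qed
  have "(\<lambda>k. \<nu> (w (k + N))) \<longlonglongrightarrow> v - t"
    using \<nu>(1) U wlim LIMSEQ_ignore_initial_segment[OF wlim, of N] N
    unfolding \<nu>(2)[symmetric] by (intro continuous_on_tendsto_compose[OF \<nu>(1)]) auto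
  then have "(\<lambda>k. r (k + N)) \<longlonglongrightarrow> ((v, s), y) - ((v - t, 0), 0)"
    unfolding r_def
    by (intro tendsto_diff tendsto_Pair tendsto_const LIMSEQ_ignore_initial_segment[OF plim])
  then have "((t, s), y) \<in> outer_limit (regular_normal_cone G) q G"
    by (intro outer_limitI[where z = "\<lambda>k. z (k + N)" and vs = "\<lambda>k. r (k + N)"]
        LIMSEQ_ignore_initial_segment[OF zlim]) (simp_all add: z reg)
  then show ?thesis using q by (simp add: normal_cone_def)
qed

text \<open>The embedding by \<open>(z, 0)\<close> sends tangents of the section to tangents of
  \<open>G\<close>, and polarity reverses this. Limiting normals do not restrict in this way in
  general, hence the appeal to graphical regularity later.\<close>

lemma regular_normal_cone_section:
  fixes G :: "('a::euclidean_space \<times> 'b::euclidean_space) set"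
  assumes "(v, y) \<in> regular_normal_cone G (z, 0)"
  shows "v \<in> regular_normal_cone {z. (z, 0) \<in> G} z"
proof -
  have "(d, 0) \<in> tangent_cone G (z, 0)" if "d \<in> tangent_cone {z. (z, 0) \<in> G} z" for d
    using tangent_cone_linear_image[OF _ _ that, of "\<lambda>z. (z, 0)" 0 G]
    by (simp add: bounded_linear_Pair bounded_linear_ident bounded_linear_zero)
  then show ?thesis
    using assms by (fastforce simp: regular_normal_cone_def polar_cone_def split: if_splits)
qed

section \<open>Projectional coderivatives of the solution mapping\<close>

lemma gph_solution_map:
  fixes M :: "'a \<times> 'b \<Rightarrow> ('c::zero) set"
  assumes "\<And>w. S w = {x. 0 \<in> M (w, x)}"
  shows "gph (mrestrict S W) = {z. (z, 0) \<in> gph (mrestrict M (W \<times> UNIV))}"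
  by (auto simp: gph_def mrestrict_def assms split: if_splits)

lemma gph_mrestrict: "gph (mrestrict F X) = gph F \<inter> X \<times> UNIV"
  by (auto simp: gph_def mrestrict_def split: if_splits)

lemma mem_projection_of_set_Times_UNIV:
  "(t, a) \<in> projection_of_set (K \<times> UNIV) Z \<longleftrightarrow> (\<exists>v. (v, a) \<in> Z \<and> t \<in> projection K v)"
  unfolding projection_of_set_def UN_iff Bex_def split_paired_Ex projection_Times_UNIV by auto

lemma closed_gph_mrestrict:
  assumes "closed (gph F)" "closed X"
  shows "closed (gph (mrestrict F X))"
  unfolding gph_mrestrict by (intro closed_Int closed_Times closed_UNIV assms)

text \<open>Removes the minus sign of the coderivative from the qualifications, where
  \<open>y\<close> is universally quantified.\<close>

lemma all_uminus_iff:
  fixes P :: "'a::group_add \<Rightarrow> bool"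
  shows "(\<forall>y. P (- y)) \<longleftrightarrow> (\<forall>y. P y)"
  by (metis minus_minus)

lemma basic_CQ_iff:
  "basic_CQ M W w x \<longleftrightarrow> (\<forall>y. (0, y) \<in> normal_cone (gph (mrestrict M (W \<times> UNIV))) ((w, x), 0) \<longrightarrow> y = 0)"
  (is "_ \<longleftrightarrow> ?R")
proof -
  have "basic_CQ M W w x \<longleftrightarrow>
      (\<forall>y. (0, - y) \<in> normal_cone (gph (mrestrict M (W \<times> UNIV))) ((w, x), 0) \<longrightarrow> - y = 0)"
    by (simp add: basic_CQ_def coderivative_def zero_prod_def)
  also have "\<dots> \<longleftrightarrow> ?R" by (rule all_uminus_iff)
  finally show ?thesis .
qed

lemma strong_CQ_iff:
  "strong_CQ M W w x \<longleftrightarrow> (\<forall>y. (0, y) \<in>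
    outer_limit (\<lambda>(z, u). projection_of_set (tangent_cone (W \<times> UNIV) z \<times> UNIV)
      (normal_cone (gph (mrestrict M (W \<times> UNIV))) (z, u)))
    ((w, x), 0) (gph (mrestrict M (W \<times> UNIV))) \<longrightarrow> y = 0)"
  (is "_ \<longleftrightarrow> (\<forall>y. ?Q y \<longrightarrow> _)")
proof -
  have "strong_CQ M W w x \<longleftrightarrow> (\<forall>y. ?Q (- y) \<longrightarrow> - y = 0)"
    by (simp add: strong_CQ_def proj_coderivative_def zero_prod_def)
  also have "\<dots> \<longleftrightarrow> (\<forall>y. ?Q y \<longrightarrow> y = 0)"
    by (rule all_uminus_iff[of "\<lambda>y. ?Q y \<longrightarrow> y = 0"])
  finally show ?thesis .
qed

text \<open>The cone is full in the \<open>x\<close> and \<open>u\<close> coordinates, so the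
  projection moves only the \<open>w\<close>-component of a normal.\<close>

lemma mem_projected_normals_iff:
  "((t, s), y) \<in> projection_of_set (tangent_cone (W \<times> UNIV) (w, x) \<times> UNIV) Z \<longleftrightarrow>
    (\<exists>v. ((v, s), y) \<in> Z \<and> t \<in> projection (tangent_cone W w) v)"
  unfolding mem_projection_of_set_Times_UNIV tangent_cone_Times_UNIV split_paired_Ex
  by (simp add: projection_Times_UNIV)

text \<open>A normal whose first component is 0 projects to itself, because 0 is tangent to
  \<open>W\<close>; constant sequences then place it in the outer limit.\<close>

lemma strong_CQ_imp_basic_CQ:
  assumes "strong_CQ M W w x"
  shows "basic_CQ M W w x"
  unfolding basic_CQ_iff
proof (intro allI impI)
  fix y assume y: "(0, y) \<in> normal_cone (gph (mrestrict M (W \<times> UNIV))) ((w, x), 0)"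
  then have G: "((w, x), 0) \<in> gph (mrestrict M (W \<times> UNIV))"
    by (auto simp: normal_cone_def split: if_splits)
  then have "w \<in> W" by (auto simp: gph_def mrestrict_def split: if_splits)
  have "(0, y) \<in> projection_of_set (tangent_cone (W \<times> UNIV) (w, x) \<times> UNIV)
      (normal_cone (gph (mrestrict M (W \<times> UNIV))) ((w, x), 0))"
    unfolding zero_prod_def mem_projected_normals_iff
    using y projection_self[OF zero_mem_tangent_cone[OF \<open>w \<in> W\<close>]] by (auto simp: zero_prod_def)
  then have "(0, y) \<in>
    outer_limit (\<lambda>(z, u). projection_of_set (tangent_cone (W \<times> UNIV) z \<times> UNIV)
      (normal_cone (gph (mrestrict M (W \<times> UNIV))) (z, u)))
    ((w, x), 0) (gph (mrestrict M (W \<times> UNIV)))"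
    by (intro outer_limitI[where z = "\<lambda>_. ((w, x), 0)" and vs = "\<lambda>_. (0, y)"] G tendsto_const) simp
  then show "y = 0" using assms unfolding strong_CQ_iff by blast
qed

section \<open>The three inclusions\<close>

text \<open>Each approximating normal of the section is lifted at its own base point, where the
  qualification still holds for late indices. The multipliers \<open>y\<close> need not converge,
  since the estimate takes the union over \<open>y\<close> before the outer limit.\<close>

lemma proj_coderivative_subset_outer_estimate:
  assumes M: "closed (gph M)" and S: "\<And>w. S w = {x. 0 \<in> M (w, x)}" and W: "closed W"
    and xbar: "xbar \<in> mrestrict S W wbar" and cq: "basic_CQ M W wbar xbar"
  shows "proj_coderivative S W wbar xbar r \<subseteq> outer_estimate M S W wbar xbar r"
proof
  define G where "G = gph (mrestrict M (W \<times> UNIV))"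
  have G: "closed G"
    unfolding G_def by (intro closed_gph_mrestrict M closed_Times W closed_UNIV)
  have sec: "gph (mrestrict S W) = {z. (z, 0) \<in> G}"
    unfolding G_def by (rule gph_solution_map[OF S])
  have bar: "((wbar, xbar), 0) \<in> G"
    using xbar sec by (auto simp: gph_def)
  fix t assume "t \<in> proj_coderivative S W wbar xbar r"
  then obtain q p where q: "\<And>k::nat. q k \<in> gph (mrestrict S W)"
    and p: "\<And>k. p k \<in> (case q k of (w, x) \<Rightarrow> projection_of_set (tangent_cone W w \<times> UNIV)
        (normal_cone (gph (mrestrict S W)) (w, x)))"
    and lim: "q \<longlonglongrightarrow> (wbar, xbar)" "p \<longlonglongrightarrow> (t, - r)"
    unfolding proj_coderivative_def mem_Collect_eq by (rule outer_limitE) (rule that; simp only:)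
  have "\<exists>v. (v, snd (p k)) \<in> normal_cone (gph (mrestrict S W)) (q k) \<and>
      fst (p k) \<in> projection (tangent_cone W (fst (q k))) v" for k
    using p[of k] mem_projection_of_set_Times_UNIV[of "fst (p k)" "snd (p k)"]
    by (cases "q k") auto
  then obtain v where v: "\<And>k. (v k, snd (p k)) \<in> normal_cone {z. (z, 0) \<in> G} (q k)"
    and proj: "\<And>k. fst (p k) \<in> projection (tangent_cone W (fst (q k))) (v k)"
    unfolding sec by metis
  have "\<forall>\<^sub>F k in sequentially. \<forall>y. (0, y) \<in> normal_cone G (q k, 0) \<longrightarrow> y = 0"
    using cq unfolding basic_CQ_iff G_def[symmetric]
    by (intro constraint_qualification_nearby[OF bar _ lim(1)]) blast
  then obtain N where N: "\<And>k y. k \<ge> N \<Longrightarrow> (0, y) \<in> normal_cone G (q k, 0) \<Longrightarrow> y = 0"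
    by (auto simp: eventually_sequentially)
  have lift: "\<exists>y. ((v k, snd (p k)), y) \<in> normal_cone G (q k, 0)" if "k \<ge> N" for k
    using normal_cone_section[OF G v N[OF that]] by blast
  show "t \<in> outer_estimate M S W wbar xbar r"
    unfolding outer_estimate_def
  \<comment> \<open>The second components of \<open>p\<close> tend to \<open>- r\<close>, so their
    negatives serve as \<open>r'\<close>; the shift by \<open>N\<close> reaches the indices at which
    lifts exist.\<close>
  proof (rule outer_limitI[where z = "\<lambda>k. (q (k + N), - snd (p (k + N)))" and vs = "\<lambda>k. fst (p (k + N))"])
    fix k
    show "(q (k + N), - snd (p (k + N))) \<in> gph (mrestrict S W) \<times> UNIV" using q by simp
    obtain y where "((v (k + N), snd (p (k + N))), - y) \<in> normal_cone G (q (k + N), 0)"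
      using lift[of "k + N"] by (metis le_add2 minus_minus)
    then show "fst (p (k + N)) \<in> (\<lambda>((w, x), r').
        \<Union>y. projection_of_set (tangent_cone W w)
          {v. (v, - r') \<in> coderivative (mrestrict M (W \<times> UNIV)) (w, x) 0 y})
        (q (k + N), - snd (p (k + N)))"
      using proj[of "k + N"]
      by (cases "q (k + N)") (auto simp: projection_of_set_def coderivative_def G_def)
  next
    have "(\<lambda>k. (q (k + N), - snd (p (k + N)))) \<longlonglongrightarrow> ((wbar, xbar), - snd (t, - r))"
      by (intro tendsto_Pair tendsto_minus tendsto_snd LIMSEQ_ignore_initial_segment lim)
    then show "(\<lambda>k. (q (k + N), - snd (p (k + N)))) \<longlonglongrightarrow> ((wbar, xbar), r)" by simp
    have "(\<lambda>k. fst (p (k + N))) \<longlonglongrightarrow> fst (t, - r)"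
      by (intro tendsto_fst LIMSEQ_ignore_initial_segment lim)
    then show "(\<lambda>k. fst (p (k + N))) \<longlonglongrightarrow> t" by simp
  qed
qed

text \<open>Elements of the estimate together with their multipliers are projected normals of
  \<open>G\<close> at points \<open>(z, 0)\<close>. Projected normals form cones, and the strong
  qualification is the hypothesis under which \<open>outer_limit_cone_lift\<close> yields a limiting
  multiplier.\<close>

lemma outer_estimate_subset_pointwise_estimate:
  assumes S: "\<And>w. S w = {x. 0 \<in> M (w, x)}" and cq: "strong_CQ M W wbar xbar"
  shows "outer_estimate M S W wbar xbar r \<subseteq> pointwise_estimate M W wbar xbar r"
proof
  define G where "G = gph (mrestrict M (W \<times> UNIV))"
  define H where "H = (\<lambda>(z, u). projection_of_set (tangent_cone (W \<times> UNIV) z \<times> UNIV) (normal_cone G (z, u)))"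
  have sec: "gph (mrestrict S W) = {z. (z, 0) \<in> G}"
    unfolding G_def by (rule gph_solution_map[OF S])
  fix t assume "t \<in> outer_estimate M S W wbar xbar r"
  then obtain z ts where z: "\<And>k::nat. z k \<in> gph (mrestrict S W) \<times> UNIV"
    and ts: "\<And>k. ts k \<in> (\<lambda>((w, x), r'). \<Union>y. projection_of_set (tangent_cone W w)
          {v. (v, - r') \<in> coderivative (mrestrict M (W \<times> UNIV)) (w, x) 0 y}) (z k)"
    and lim: "z \<longlonglongrightarrow> ((wbar, xbar), r)" "ts \<longlonglongrightarrow> t"
    unfolding outer_estimate_def by (rule outer_limitE) (rule that; simp only:)
  have "\<exists>y. ((ts k, - snd (z k)), y) \<in> H (fst (z k), 0)" for k
  proof -
    obtain w x r' where zk: "z k = ((w, x), r')" by (metis surj_pair)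
    then obtain y v where "((v, - r'), - y) \<in> normal_cone G ((w, x), 0)"
      "ts k \<in> projection (tangent_cone W w) v"
      using ts[of k] by (auto simp: projection_of_set_def coderivative_def G_def)
    then show ?thesis
      unfolding H_def zk by (auto simp: mem_projected_normals_iff)
  qed
  then obtain y where y: "\<And>k. ((ts k, - snd (z k)), y k) \<in> H (fst (z k), 0)" by metis
  obtain y' where "((t, - r), y') \<in> outer_limit H ((wbar, xbar), 0) G"
  proof (rule outer_limit_cone_lift[of H "((wbar, xbar), 0)" G "\<lambda>k. (fst (z k), 0)"
        "\<lambda>k. (ts k, - snd (z k))" y "(t, - r)"])
    show "c *\<^sub>R p \<in> H q" if "p \<in> H q" "c > 0" for q p c
      using that unfolding H_def
      by (cases q)
        (auto simp: tangent_cone_Times_UNIV intro!: projection_of_set_scale normal_cone_scale tangent_cone_scale)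
    show "y = 0" if "(0, y) \<in> outer_limit H ((wbar, xbar), 0) G" for y
      using cq[unfolded strong_CQ_iff] that unfolding H_def G_def by (elim allE impE)
    show "(fst (z k), 0) \<in> G" for k using z[of k] sec by auto
    have "(\<lambda>k. (fst (z k), 0)) \<longlonglongrightarrow> (fst ((wbar, xbar), r), 0)"
      by (intro tendsto_Pair tendsto_fst lim tendsto_const)
    then show "(\<lambda>k. (fst (z k), 0)) \<longlonglongrightarrow> ((wbar, xbar), 0)" by simp
    have "(\<lambda>k. (ts k, - snd (z k))) \<longlonglongrightarrow> (t, - snd ((wbar, xbar), r))"
      by (intro tendsto_Pair tendsto_minus tendsto_snd lim)
    then show "(\<lambda>k. (ts k, - snd (z k))) \<longlonglongrightarrow> (t, - r)" by simp
  qed (rule y)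
  then have "((t, - r), - (- y')) \<in> outer_limit H ((wbar, xbar), 0) G" by simp
  then show "t \<in> pointwise_estimate M W wbar xbar r"
    unfolding pointwise_estimate_def proj_coderivative_def mem_Collect_eq H_def G_def
    by (rule exI[of _ "- y'"])
qed

text \<open>Near the base point projected normals are again normals, with tangent
  \<open>w\<close>-component. Both properties survive the limit, where regularity lets the normal
  descend to the section.\<close>

lemma pointwise_estimate_subset_proj_coderivative:
  assumes S: "\<And>w. S w = {x. 0 \<in> M (w, x)}"
    and reg: "graphically_regular_at (mrestrict M (W \<times> UNIV)) (wbar, xbar) 0"
    and W: "smooth_manifold_at W wbar"
  shows "pointwise_estimate M W wbar xbar r \<subseteq> proj_coderivative S W wbar xbar r"
proof
  define G where "G = gph (mrestrict M (W \<times> UNIV))"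
  have sec: "gph (mrestrict S W) = {z. (z, 0) \<in> G}"
    unfolding G_def by (rule gph_solution_map[OF S])
  have GW: "fst (fst q) \<in> W" if "q \<in> G" for q
    using that by (auto simp: G_def gph_mrestrict)
  have bar: "((wbar, xbar), 0) \<in> G" and
    normal: "normal_cone G ((wbar, xbar), 0) = regular_normal_cone G ((wbar, xbar), 0)"
    using reg by (auto simp: graphically_regular_at_def regular_at_def G_def)
  obtain U n g where U: "open U" "wbar \<in> U" and cont: "\<And>i::nat. i < n \<Longrightarrow> continuous_on U (g i)"
    and T: "\<And>w. w \<in> W \<inter> U \<Longrightarrow> tangent_cone W w = {p. \<forall>i<n. g i w \<bullet> p = 0}"
    using tangent_cone_smooth_manifold[OF W] by blast
  fix t assume "t \<in> pointwise_estimate M W wbar xbar r"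
  then obtain y where "((t, - r), - y) \<in> outer_limit (\<lambda>(x, u).
      projection_of_set (tangent_cone (W \<times> UNIV) x \<times> UNIV) (normal_cone G (x, u)))
      ((wbar, xbar), 0) G"
    unfolding pointwise_estimate_def proj_coderivative_def mem_Collect_eq G_def by (rule exE)
  then obtain z p where z: "\<And>k::nat. z k \<in> G"
    and p: "\<And>k. p k \<in> (case z k of (x, u) \<Rightarrow>
        projection_of_set (tangent_cone (W \<times> UNIV) x \<times> UNIV) (normal_cone G (x, u)))"
    and zlim: "z \<longlonglongrightarrow> ((wbar, xbar), 0)" and plim: "p \<longlonglongrightarrow> ((t, - r), - y)"
    by (rule outer_limitE) (rule that; simp only:)
  define w where "w k = fst (fst (z k))" for k
  have "w \<longlonglongrightarrow> fst (fst ((wbar, xbar), 0::'c))" unfolding w_def by (intro tendsto_fst zlim)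
  then have wlim: "w \<longlonglongrightarrow> wbar" by simp
  then have "\<forall>\<^sub>F k in sequentially. w k \<in> U" using U by (rule topological_tendstoD)
  then obtain N where N: "\<And>k. k \<ge> N \<Longrightarrow> w k \<in> U" by (auto simp: eventually_sequentially)
  have *: "p k \<in> normal_cone G (z k) \<and> fst (fst (p k)) \<in> tangent_cone W (w k)" if "k \<ge> N" for k
  proof -
    obtain t' s' y' where pk: "p k = ((t', s'), y')" by (metis surj_pair)
    obtain x' u' where zk: "z k = ((w k, x'), u')" unfolding w_def by (metis surj_pair fst_conv)
    obtain v where v: "((v, s'), y') \<in> normal_cone G (z k)" "t' \<in> projection (tangent_cone W (w k)) v"
      using p[of k] by (auto simp: pk zk mem_projected_normals_iff)
    have "((t', s'), y') \<in> normal_cone G (z k)"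
      by (rule normal_cone_project_tangent[OF GW T cont U(1) _ v(1)])
        (use N[OF that] v(2) in \<open>auto simp: w_def\<close>)
    then show ?thesis using v(2) by (simp add: pk mem_projection_iff)
  qed
  have "((t, - r), - y) \<in> normal_cone G ((wbar, xbar), 0)"
    by (rule normal_cone_outer_semicontinuous[where z = "\<lambda>k. z (k + N)" and vs = "\<lambda>k. p (k + N)"])
      (use * bar in \<open>auto intro: LIMSEQ_ignore_initial_segment zlim plim\<close>)
  then have "(t, - r) \<in> regular_normal_cone {z. (z, 0) \<in> G} (wbar, xbar)"
    unfolding normal by (rule regular_normal_cone_section)
  then have tr: "(t, - r) \<in> normal_cone (gph (mrestrict S W)) (wbar, xbar)"
    unfolding sec using regular_normal_cone_subset by blast
  \<comment> \<open>Tangency passes to the limit because the fields \<open>g i\<close> are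
    continuous and tangent spaces are their common kernels.\<close>
  have "g i wbar \<bullet> t = 0" if "i < n" for i
  proof -
    have "(\<lambda>k. g i (w (k + N)) \<bullet> fst (fst (p (k + N)))) \<longlonglongrightarrow> g i wbar \<bullet> fst (fst ((t, - r), - y))"
      using U(2) N by (intro tendsto_inner tendsto_fst LIMSEQ_ignore_initial_segment plim
          continuous_on_tendsto_compose[OF cont[OF that]] wlim) auto
    moreover have "g i (w (k + N)) \<bullet> fst (fst (p (k + N))) = 0" for k
      using *[of "k + N"] T[of "w (k + N)"] N[of "k + N"] GW[OF z] that by (auto simp: w_def)
    ultimately show ?thesis by (simp add: LIMSEQ_const_iff)
  qed
  then have "t \<in> tangent_cone W wbar"
    using T[of wbar] U(2) GW[OF bar] by simp
  \<comment> \<open>Being tangent, \<open>t\<close> is its own projection. The outer limit includes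
    the base point, so constant sequences finish the argument.\<close>
  then have "(t, - r) \<in> projection_of_set (tangent_cone W wbar \<times> UNIV)
      (normal_cone (gph (mrestrict S W)) (wbar, xbar))"
    unfolding mem_projection_of_set_Times_UNIV using tr projection_self by blast
  then show "t \<in> proj_coderivative S W wbar xbar r"
    unfolding proj_coderivative_def mem_Collect_eq
    by (intro outer_limitI[where z = "\<lambda>_. (wbar, xbar)" and vs = "\<lambda>_. (t, - r)"] tendsto_const)
      (use bar sec in auto)
qed

theorem corollary3p6:
  fixes M :: "(real ^ 'm) \<times> (real ^ 'n) \<Rightarrow> (real ^ 'd) set"
    and S :: "real ^ 'm \<Rightarrow> (real ^ 'n) set"
    and W :: "(real ^ 'm) set"
    and wbar :: "real ^ 'm" and xbar :: "real ^ 'n"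
  assumes "closed (gph M)"
    and "\<And>w. S w = {x. 0 \<in> M (w, x)}"
    and "closed W"
    and "xbar \<in> mrestrict S W wbar"
  shows "(basic_CQ M W wbar xbar \<longrightarrow>
           (\<forall>r. proj_coderivative S W wbar xbar r \<subseteq> outer_estimate M S W wbar xbar r)) \<and>
         (strong_CQ M W wbar xbar \<longrightarrow>
           (\<forall>r. proj_coderivative S W wbar xbar r \<subseteq> pointwise_estimate M W wbar xbar r)) \<and>
         (strong_CQ M W wbar xbar \<and>
         graphically_regular_at (mrestrict M (W \<times> UNIV)) (wbar, xbar) 0 \<and>
         smooth_manifold_at W wbar \<longrightarrow>
           (\<forall>r. outer_estimate M S W wbar xbar r = pointwise_estimate M W wbar xbar r \<and>
                proj_coderivative S W wbar xbar r = outer_estimate M S W wbar xbar r \<and>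
                proj_coderivative S W wbar xbar r = pointwise_estimate M W wbar xbar r))"
proof -
  have outer: "proj_coderivative S W wbar xbar r \<subseteq> outer_estimate M S W wbar xbar r"
    if "basic_CQ M W wbar xbar" for r
    using assms that by (rule proj_coderivative_subset_outer_estimate)
  have pointwise: "outer_estimate M S W wbar xbar r \<subseteq> pointwise_estimate M W wbar xbar r"
    if "strong_CQ M W wbar xbar" for r
    using assms(2) that by (rule outer_estimate_subset_pointwise_estimate)
  have converse: "pointwise_estimate M W wbar xbar r \<subseteq> proj_coderivative S W wbar xbar r"
    if "graphically_regular_at (mrestrict M (W \<times> UNIV)) (wbar, xbar) 0" "smooth_manifold_at W wbar" for r
    using assms(2) that by (rule pointwise_estimate_subset_proj_coderivative)
  \<comment> \<open>The strong qualification implies the basic one, so under the hypotheses of the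
    last claim the three inclusions close into a cycle and all three sets agree.\<close>
  show ?thesis
    using outer pointwise converse strong_CQ_imp_basic_CQ[of M W wbar xbar] by (meson subset_antisym subset_trans)
qed

end
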